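(* Let $U,V$ be subspaces of $\mathbb{R}^n$ with $1\le p:=\dim U\le q:=\dim V\le n-1$. Let $R:=P_UP_V+P_{U^\perp}P_{V^\perp}$ and, for $\mu\in\mathbb{R}$, let $R_\mu:=(1-\mu)\mathrm{Id}+\mu R$. Then $R_\mu$ is convergent if and only if $\mu\in[0,2)$. Moreover, the following assertions hold: (i) $R_\mu$ is normal. (ii) If $\mu\in(0,2)$, then $R_\mu$ is convergent to $P_{\mathrm{Fix}\,R}=P_{(U\cap V)\oplus(U^\perp\cap V^\perp)}$ with the optimal convergence rate $\gamma(R_\mu)=\sqrt{\mu(2-\mu)\cos^2\theta_{s+1}+(1-\mu)^2}$, where $s:=\dim(U\cap V)$ and $\theta_{s+1}$ is the $(s+1)$-th principal angle between $U$ and $V$, which is the Friedrichs angle $\theta_F$.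
   Context: $P_W$ denotes the orthogonal projection onto a subspace $W$ of $\mathbb{R}^n$, $W^\perp$ is the orthogonal complement of $W$, $\mathrm{Id}$ is the identity, $\mathrm{Fix}\,A:=\ker(A-\mathrm{Id})$, and $\|\cdot\|$ applied to matrices is the operator norm. A matrix $A$ is normal if it commutes with its adjoint. A matrix $A$ is convergent to $A^\infty$ if $\|A^k-A^\infty\|\to0$ as $k\to\infty$; it is convergent if such a limit exists. It is (linearly) convergent to $A^\infty$ with rate $r\in[0,1)$ if there are $M,N>0$ such that $\|A^k-A^\infty\|\le M r^k$ for all $k\in\mathbb{N}$, $k>N$; if the infimum of all such rates is itself a rate, it is called the optimal convergence rate. $\gamma(A):=\max\{|\lambda|:\lambda\in(\{0\}\cup\sigma(A))\setminus\{1\}\}$, where $\sigma(A)$ is the set of (complex) eigenvalues of $A$. The principal angles $\theta_1\le\dots\le\theta_p$ in $[0,\frac{\pi}{2}]$ between $U$ and $V$ are defined recursively by $\cos\theta_k:=\langle u_k,v_k\rangle=\max\{\langle u,v\rangle: u\in U, v\in V, \|u\|=\|v\|=1, \langle u,u_j\rangle=\langle v,v_j\rangle=0 \text{ for } j=1,\dots,k-1\}$, where $(u_k,v_k)$ is a maximizing pair; the angles do not depend on the choice of maximizers. The Friedrichs angle $\theta_F\in(0,\frac{\pi}{2}]$ between $U$ and $V$ is the angle whose cosine is $\max\{\langle u,v\rangle: u\in U\cap(U\cap V)^\perp, v\in V\cap(U\cap V)^\perp,\|u\|=\|v\|=1\}$. One has $\theta_k=0$ for $k=1,\dots,s$ and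 $\theta_{s+1}=\theta_F>0$.
   Formalization: The equivalence "convergent iff μ∈[0,2)" and the formula for γ(R_μ) are stated only for U ≠ V, since for U = V one has R_μ = Id for every μ; when U ⊆ V, the undefined angles θ_{s+1} and θ_F are taken to be π/2. *)

theory Defs
  imports "HOL-Analysis.Analysis"
begin

definition proj_mat :: "(real^'n) set \<Rightarrow> real^'n^'n" where
  "proj_mat W = matrix (\<lambda>x. THE y. y \<in> W \<and> x - y \<in> W\<^sup>\<bottom>)"

(* Powers with respect to the matrix product: the type-class power on real^'n^'n is the
   entrywise one. *)
primrec matpow :: "real^'n^'n \<Rightarrow> nat \<Rightarrow> real^'n^'n" where
  "matpow A 0 = mat 1"
| "matpow A (Suc k) = A ** matpow A k"

definition opnorm :: "real^'n^'n \<Rightarrow> real" where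
  "opnorm A = onorm ((*v) A)"

definition fix_space :: "real^'n^'n \<Rightarrow> (real^'n) set" where
  "fix_space A = {x. (A - mat 1) *v x = 0}"

definition normal_mat :: "real^'n^'n \<Rightarrow> bool" where
  "normal_mat A \<longleftrightarrow> A ** transpose A = transpose A ** A"

definition mat_convergent_to :: "real^'n^'n \<Rightarrow> real^'n^'n \<Rightarrow> bool" where
  "mat_convergent_to A L \<longleftrightarrow> (\<lambda>k. opnorm (matpow A k - L)) \<longlonglongrightarrow> 0"

definition mat_convergent :: "real^'n^'n \<Rightarrow> bool" where
  "mat_convergent A \<longleftrightarrow> (\<exists>L. mat_convergent_to A L)"

definition is_conv_rate :: "real^'n^'n \<Rightarrow> real^'n^'n \<Rightarrow> real \<Rightarrow> bool" where
  "is_conv_rate A L r \<longleftrightarrow> 0 \<le> r \<and> r < 1 \<and>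
     (\<exists>M>0. \<exists>N>0. \<forall>k::nat. k > N \<longrightarrow> opnorm (matpow A k - L) \<le> M * r ^ k)"

definition is_optimal_conv_rate :: "real^'n^'n \<Rightarrow> real^'n^'n \<Rightarrow> real \<Rightarrow> bool" where
  "is_optimal_conv_rate A L r \<longleftrightarrow> is_conv_rate A L r \<and> r = Inf {r'. is_conv_rate A L r'}"

definition eigvals :: "real^'n^'n \<Rightarrow> complex set" where
  "eigvals A = {z. \<exists>x. x \<noteq> 0 \<and> map_matrix complex_of_real A *v x = z *s x}"

definition gamma_mat :: "real^'n^'n \<Rightarrow> real" where
  "gamma_mat A = Max (cmod ` ((insert 0 (eigvals A)) - {1}))"

definition principal_admissible ::
  "(real^'n) set \<Rightarrow> (real^'n) set \<Rightarrow> (nat \<Rightarrow> real^'n) \<Rightarrow> (nat \<Rightarrow> real^'n) \<Rightarrow> nat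
    \<Rightarrow> real^'n \<Rightarrow> real^'n \<Rightarrow> bool" where
  "principal_admissible U V u v k x y \<longleftrightarrow>
     x \<in> U \<and> y \<in> V \<and> norm x = 1 \<and> norm y = 1 \<and>
     (\<forall>j\<in>{1..<k}. x \<bullet> u j = 0 \<and> y \<bullet> v j = 0)"

(* Each pair (u j, v j), j = 1..k, is a maximizing pair relative to the earlier ones. *)
definition principal_vectors ::
  "(real^'n) set \<Rightarrow> (real^'n) set \<Rightarrow> nat \<Rightarrow> (nat \<Rightarrow> real^'n) \<Rightarrow> (nat \<Rightarrow> real^'n) \<Rightarrow> bool" where
  "principal_vectors U V k u v \<longleftrightarrow>
     (\<forall>j\<in>{1..k}. principal_admissible U V u v j (u j) (v j) \<and>
        (\<forall>x y. principal_admissible U V u v j x y \<longrightarrow> x \<bullet> y \<le> u j \<bullet> v j))"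

(* The k-th principal angle, k >= 1; it does not depend on the maximizing pairs chosen.
   For k > min (dim U) (dim V) there is no admissible pair; the value is then pi/2 by
   convention (maximal cosine 0). *)
definition principal_angle :: "(real^'n) set \<Rightarrow> (real^'n) set \<Rightarrow> nat \<Rightarrow> real" where
  "principal_angle U V k =
     (if k \<le> min (dim U) (dim V)
      then THE \<theta>. 0 \<le> \<theta> \<and> \<theta> \<le> pi/2 \<and>
             (\<exists>u v. principal_vectors U V k u v \<and> cos \<theta> = u k \<bullet> v k)
      else pi/2)"

definition friedrichs_cosines :: "(real^'n) set \<Rightarrow> (real^'n) set \<Rightarrow> real set" where
  "friedrichs_cosines U V =
     {x \<bullet> y | x y. x \<in> U \<inter> (U \<inter> V)\<^sup>\<bottom> \<and> y \<in> V \<inter> (U \<inter> V)\<^sup>\<bottom> \<and> norm x = 1 \<and> norm y = 1}"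

(* If one subspace contains the other, there is no pair of unit vectors to maximize over;
   the value is then pi/2 by the usual convention (maximal cosine 0). *)
definition friedrichs_angle :: "(real^'n) set \<Rightarrow> (real^'n) set \<Rightarrow> real" where
  "friedrichs_angle U V =
     (if friedrichs_cosines U V \<noteq> {}
      then THE \<theta>. 0 < \<theta> \<and> \<theta> \<le> pi/2 \<and> cos \<theta> = (GREATEST c. c \<in> friedrichs_cosines U V)
      else pi/2)"

definition dr_mat :: "(real^'n) set \<Rightarrow> (real^'n) set \<Rightarrow> real^'n^'n" where
  "dr_mat U V = proj_mat U ** proj_mat V + proj_mat (U\<^sup>\<bottom>) ** proj_mat (V\<^sup>\<bottom>)"

definition relaxed_dr_mat :: "(real^'n) set \<Rightarrow> (real^'n) set \<Rightarrow> real \<Rightarrow> real^'n^'n" where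
  "relaxed_dr_mat U V \<mu> = (1 - \<mu>) *\<^sub>R mat 1 + \<mu> *\<^sub>R dr_mat U V"

end

theory Submission
  imports Defs
begin

text \<open>
  Write P, Q for the projections onto U, V, and D = P - Q. Instead of block matrices
  in a basis of principal vectors, the proof uses the square D^2 = P + Q - P Q - Q P, which
  commutes with P and Q, hence with R and R_\<mu>. Expanding inner products gives
  |R x|^2 = \<langle>x, R x\<rangle> = |x|^2 - |D x|^2, and therefore the norm identity (lemma norm_T)

    |R_\<mu> x|^2 = (1 - \<mu>)^2 |x|^2 + \<mu> (2 - \<mu>) (|x|^2 - |D x|^2).

  In particular the fixed space of R is E = ker D, which is the sum of U \<inter> V and
  U^\<bottom> \<inter> V^\<bottom>. The operator R_\<mu> is the identity on E and leaves E^\<bottom> invariant, so everything is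
  decided by the smallest value of |D x|^2 on the unit sphere of E^\<bottom>. It is an eigenvalue of
  D^2, and lemma minimal_gap identifies it as 1 - c^2 with c the Friedrichs cosine.

  Let U and V be distinct, 0 < \<mu> < 2 and g^2 = \<mu> (2 - \<mu>) c^2 + (1 - \<mu>)^2. The norm identity makes R_\<mu> a
  g-contraction on E^\<bottom>, so the powers of R_\<mu> converge to the projection onto E at rate g and
  each eigenvalue other than 1 has modulus at most g. Both bounds are sharp because of the minimizing
  eigenvector x of D^2: on the eigenspace of x, which R_\<mu> preserves, R_\<mu> multiplies norms by
  exactly g, and it satisfies there a real quadratic equation whose roots have modulus g.
  If \<mu> is not in (0,2), the norm identity shows that R_\<mu> never shortens a vector; then
  consecutive powers cannot come closer to each other, and convergence forces R_\<mu> = Id,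
  that is, \<mu> = 0 or U = V.

  For the angles, the first s principal pairs are pairs of equal vectors and form an orthonormal basis
  of U \<inter> V, so the pairs admissible at step s + 1 are exactly those that define the Friedrichs
  angle.
\<close>

section \<open>Two orthogonal projections\<close>

lemma quadratic_nonneg_imp_linear_zero:
  fixes a K :: real
  assumes "\<And>t. 0 \<le> 2 * t * a + t\<^sup>2 * K"
  shows "a = 0"
proof (rule ccontr)
  assume "a \<noteq> 0"
  define L where "L = \<bar>K\<bar> + 1"
  have "L > 0" "K < L" unfolding L_def by auto
  have "0 \<le> 2 * (- a / L) * a + (- a / L)\<^sup>2 * K"
    by (rule assms)
  also have "\<dots> = a\<^sup>2 / L\<^sup>2 * (K - 2 * L)"
    using \<open>L > 0\<close> by (simp add: field_simps power2_eq_square)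
  also have "\<dots> < 0"
    using \<open>a \<noteq> 0\<close> \<open>L > 0\<close> \<open>K < L\<close> by (intro mult_pos_neg) auto
  finally show False by simp
qed

text \<open>
  The part of the spectral theorem that the argument uses: the minimum of |A x|^2 over the unit
  sphere of an invariant subspace S is attained by compactness, and since A is self-adjoint,
  stationarity says that a minimizer is an eigenvector of A^2.
\<close>

lemma exists_minimal_singular_vector:
  fixes A :: "'a::euclidean_space \<Rightarrow> 'a"
  assumes lin: "linear A" and sym: "\<And>x y. A x \<bullet> y = x \<bullet> A y"
    and S: "subspace S" and inv: "\<And>x. x \<in> S \<Longrightarrow> A x \<in> S" and nontrivial: "S \<noteq> {0}"
  obtains x \<delta> where "x \<in> S" "norm x = 1" "A (A x) = \<delta> *\<^sub>R x"
    "\<And>y. y \<in> S \<Longrightarrow> \<delta> * (norm y)\<^sup>2 \<le> (norm (A y))\<^sup>2"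
proof -
  interpret A: linear A by (rule lin)
  define K where "K = S \<inter> sphere 0 1"
  have "compact K"
    unfolding K_def using S by (simp add: closed_Int_compact closed_subspace)
  obtain z where "z \<in> S" "z \<noteq> 0"
    using nontrivial S subspace_0 by blast
  then have "inverse (norm z) *\<^sub>R z \<in> K"
    unfolding K_def using S by (simp add: subspace_scale)
  then have "K \<noteq> {}" by blast
  have "continuous_on K (\<lambda>y. (norm (A y))\<^sup>2)"
    using lin by (intro continuous_intros linear_continuous_on) (simp add: linear_conv_bounded_linear)
  then obtain x where x: "x \<in> K" and min: "\<And>y. y \<in> K \<Longrightarrow> (norm (A x))\<^sup>2 \<le> (norm (A y))\<^sup>2"
    using continuous_attains_inf[OF \<open>compact K\<close> \<open>K \<noteq> {}\<close>] by blast
  define \<delta> where "\<delta> = (norm (A x))\<^sup>2"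
  have xS: "x \<in> S" and x1: "norm x = 1"
    using x unfolding K_def by auto
  have le: "\<delta> * (norm y)\<^sup>2 \<le> (norm (A y))\<^sup>2" if "y \<in> S" for y
  proof (cases "y = 0")
    case False
    then have "inverse (norm y) *\<^sub>R y \<in> K"
      unfolding K_def using S that by (simp add: subspace_scale)
    from min[OF this] have "\<delta> \<le> (norm (A y))\<^sup>2 / (norm y)\<^sup>2"
      unfolding \<delta>_def by (simp add: A.scaleR power_mult_distrib field_simps)
    then show ?thesis using False by (simp add: field_simps)
  qed simp
  define h where "h = A (A x) - \<delta> *\<^sub>R x"
  have hS: "h \<in> S"
    unfolding h_def using S inv xS by (simp add: subspace_diff subspace_scale)
  \<comment> \<open>The quadratic form |A y|^2 - \<delta> |y|^2 is nonnegative on S and vanishes at x, so its derivative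
      at x in the direction h, which is 2 |h|^2, must vanish.\<close>
  have "0 \<le> 2 * t * (h \<bullet> h) + t\<^sup>2 * ((norm (A h))\<^sup>2 - \<delta> * (norm h)\<^sup>2)" for t
  proof -
    have "x + t *\<^sub>R h \<in> S"
      using S xS hS by (simp add: subspace_add subspace_scale)
    from le[OF this] have "0 \<le> (norm (A x + t *\<^sub>R A h))\<^sup>2 - \<delta> * (norm (x + t *\<^sub>R h))\<^sup>2"
      by (simp add: A.add A.scaleR)
    also have "\<dots> = ((norm (A x))\<^sup>2 - \<delta> * (norm x)\<^sup>2) + 2 * t * (A x \<bullet> A h - \<delta> * (x \<bullet> h))
        + t\<^sup>2 * ((norm (A h))\<^sup>2 - \<delta> * (norm h)\<^sup>2)"
      unfolding power2_norm_eq_inner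
      by (simp add: inner_simps inner_commute power2_eq_square algebra_simps)
    also have "A x \<bullet> A h - \<delta> * (x \<bullet> h) = h \<bullet> h"
    proof -
      have "A x \<bullet> A h - \<delta> * (x \<bullet> h) = (A (A x) - \<delta> *\<^sub>R x) \<bullet> h"
        using sym[of "A x" h] by (simp add: inner_diff_left)
      then show ?thesis by (simp flip: h_def)
    qed
    also have "(norm (A x))\<^sup>2 - \<delta> * (norm x)\<^sup>2 = 0"
      by (simp add: \<delta>_def x1)
    finally show ?thesis by simp
  qed
  then have "h \<bullet> h = 0" by (rule quadratic_nonneg_imp_linear_zero)
  then have "h = 0" by simp
  then have "A (A x) = \<delta> *\<^sub>R x" by (simp add: h_def)
  with that xS x1 le show thesis by blast
qed

text \<open>
  Two orthogonal projections, given as linear operators by idempotence and self-adjointness. The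
  arguments in this locale are free of coordinates; the matrices enter by interpretation.
\<close>

locale two_projections =
  fixes P Q :: "'a::euclidean_space \<Rightarrow> 'a"
  assumes linear_P: "linear P" and linear_Q: "linear Q"
    and P_idem [simp]: "P (P x) = P x" and Q_idem [simp]: "Q (Q x) = Q x"
    and P_sym: "P x \<bullet> y = x \<bullet> P y" and Q_sym: "Q x \<bullet> y = x \<bullet> Q y"
begin

sublocale P: linear P by (rule linear_P)
sublocale Q: linear Q by (rule linear_Q)

definition D :: "'a \<Rightarrow> 'a" where
  "D x = P x - Q x"

text \<open>
  The operator P Q + (Id - P) (Id - Q), multiplied out.
\<close>

definition R :: "'a \<Rightarrow> 'a" where
  "R x = x - P x - Q x + 2 *\<^sub>R P (Q x)"

definition T :: "real \<Rightarrow> 'a \<Rightarrow> 'a" where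
  "T \<mu> x = (1 - \<mu>) *\<^sub>R x + \<mu> *\<^sub>R R x"

definition E :: "'a set" where
  "E = {x. D x = 0}"

lemmas linear_simps =
  P.add P.diff P.scaleR P.neg Q.add Q.diff Q.scaleR Q.neg

lemma linear_D: "linear D"
  by (rule linearI) (simp_all add: D_def linear_simps algebra_simps)

lemma linear_T: "linear (T \<mu>)"
  by (rule linearI) (simp_all add: T_def R_def linear_simps algebra_simps)

lemma D_sym: "D x \<bullet> y = x \<bullet> D y"
  by (simp add: D_def inner_simps P_sym Q_sym)

lemma subspace_E: "subspace E"
  unfolding E_def using linear_D by (rule linear_subspace_kernel)

lemma DD: "D (D x) = P x + Q x - P (Q x) - Q (P x)"
  by (simp add: D_def linear_simps)

text \<open>
  The reason for working with the square of D: while D need not commute with P or Q, its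
  square does, so that its eigenspaces reduce every operator built from P and Q.
\<close>

lemma P_DD: "D (D (P x)) = P (D (D x))"
  by (simp add: DD linear_simps)

lemma Q_DD: "D (D (Q x)) = Q (D (D x))"
  by (simp add: DD linear_simps)

lemma T_DD: "D (D (T \<mu> x)) = T \<mu> (D (D x))"
  by (simp add: DD T_def R_def linear_simps algebra_simps)

text \<open>
  With S = Id - D^2 this reads R^2 = 2 S R - S. Indeed R + R^T = 2 S and R^T R = S for the adjoint
  R^T, so that the right-hand side is (R + R^T) R - R^T R. On an eigenspace of D^2 the operator R thus
  satisfies a scalar quadratic equation.
\<close>

lemma R_quadratic: "R (R x) = 2 *\<^sub>R (R x - D (D (R x))) - (x - D (D x))"
  by (simp add: DD R_def linear_simps algebra_simps scaleR_2)

text \<open>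
  The operator 2 R - Id = (2 P - Id) (2 Q - Id) is a product of two reflections, hence orthogonal;
  this is why |R x|^2 and the inner product of x with R x agree.
\<close>

lemma
  shows inner_R: "x \<bullet> R x = (norm x)\<^sup>2 - (norm (D x))\<^sup>2"
    and norm_R: "(norm (R x))\<^sup>2 = (norm x)\<^sup>2 - (norm (D x))\<^sup>2"
proof -
  have "x \<bullet> P x = P x \<bullet> P x" "x \<bullet> Q x = Q x \<bullet> Q x" "x \<bullet> P (Q x) = P x \<bullet> Q x"
    "P x \<bullet> P (Q x) = P x \<bullet> Q x" "Q x \<bullet> P (Q x) = P (Q x) \<bullet> P (Q x)"
    using P_sym[of x "P x"] Q_sym[of x "Q x"] P_sym[of x "Q x"] P_sym[of "P x" "Q x"]
      P_sym[of "Q x" "P (Q x)"] by simp_all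
  note eqs = this
  show "x \<bullet> R x = (norm x)\<^sup>2 - (norm (D x))\<^sup>2"
    unfolding power2_norm_eq_inner R_def D_def
    using eqs by (simp add: inner_simps inner_commute algebra_simps)
  show "(norm (R x))\<^sup>2 = (norm x)\<^sup>2 - (norm (D x))\<^sup>2"
    unfolding power2_norm_eq_inner R_def D_def
    using eqs by (simp add: inner_simps inner_commute algebra_simps)
qed

lemma norm_D_le: "norm (D x) \<le> norm x"
  using norm_R[of x] by (metis diff_ge_0_iff_ge norm_ge_zero power2_le_imp_le zero_le_power2)

lemma R_fixed_iff: "R x = x \<longleftrightarrow> x \<in> E"
proof
  assume "R x = x"
  with norm_R[of x] show "x \<in> E" by (simp add: E_def)
next
  assume "x \<in> E"
  then have "Q x = P x" by (simp add: E_def D_def)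
  then show "R x = x" by (simp add: R_def scaleR_2)
qed

lemma norm_T:
  "(norm (T \<mu> x))\<^sup>2 = (1 - \<mu>)\<^sup>2 * (norm x)\<^sup>2 + \<mu> * (2 - \<mu>) * ((norm x)\<^sup>2 - (norm (D x))\<^sup>2)"
proof -
  have "(norm (T \<mu> x))\<^sup>2 = (1 - \<mu>)\<^sup>2 * (norm x)\<^sup>2 + 2 * \<mu> * (1 - \<mu>) * (x \<bullet> R x)
      + \<mu>\<^sup>2 * (norm (R x))\<^sup>2"
    unfolding power2_norm_eq_inner T_def
    by (simp add: inner_simps inner_commute power2_eq_square algebra_simps)
  then show ?thesis
    unfolding inner_R norm_R by (simp add: power2_eq_square algebra_simps)
qed

lemma T_fixes_E: "x \<in> E \<Longrightarrow> T \<mu> x = x"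
  using R_fixed_iff[of x] by (simp add: T_def algebra_simps)

text \<open>
  The subspace E is invariant under the self-adjoint operators P and Q, hence so is its orthogonal
  complement.
\<close>

lemma P_mem_E: "x \<in> E \<Longrightarrow> P x \<in> E"
  by (auto simp: E_def D_def) (metis P_idem)

lemma Q_mem_E: "x \<in> E \<Longrightarrow> Q x \<in> E"
  by (auto simp: E_def D_def) (metis P_idem)

lemma P_mem_E_comp: "x \<in> E\<^sup>\<bottom> \<Longrightarrow> P x \<in> E\<^sup>\<bottom>"
  using P_mem_E by (auto simp: orthogonal_comp_def orthogonal_def simp flip: P_sym)

lemma Q_mem_E_comp: "x \<in> E\<^sup>\<bottom> \<Longrightarrow> Q x \<in> E\<^sup>\<bottom>"
  using Q_mem_E by (auto simp: orthogonal_comp_def orthogonal_def simp flip: Q_sym)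

lemma D_mem_E_comp: "x \<in> E\<^sup>\<bottom> \<Longrightarrow> D x \<in> E\<^sup>\<bottom>"
  by (simp add: D_def P_mem_E_comp Q_mem_E_comp subspace_diff subspace_orthogonal_comp)

lemma T_mem_E_comp: "x \<in> E\<^sup>\<bottom> \<Longrightarrow> T \<mu> x \<in> E\<^sup>\<bottom>"
  by (simp add: T_def R_def P_mem_E_comp Q_mem_E_comp subspace_diff subspace_add subspace_scale
      subspace_orthogonal_comp)

lemma E_comp_nonzero: "x \<in> E\<^sup>\<bottom> \<Longrightarrow> D x = 0 \<Longrightarrow> x = 0"
  by (auto simp: E_def orthogonal_comp_def orthogonal_def)

text \<open>
  The number c is the largest cosine between the parts of the ranges of P and Q in the
  complement of E. Let x be a minimizing eigenvector of D^2 with eigenvalue \<delta>. Its image under P, or under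
  Q if P x = 0, is nonzero and again an eigenvector, say y; it lies in one of the two ranges, and its
  projection onto the other range has squared norm (1 - \<delta>) |y|^2, so 1 - \<delta> is at most c^2.
  Conversely, if u in the range of P and v in the range of Q are unit vectors with cosine c, then
  |Q u| is at least c, and |D u|^2 = 1 - |Q u|^2 bounds \<delta> from above. For c = 0 the bound is |D x| \<le> |x|.
\<close>

lemma minimal_gap:
  assumes c0: "0 \<le> c"
    and bound: "\<And>x y. P x = x \<Longrightarrow> Q y = y \<Longrightarrow> x \<in> E\<^sup>\<bottom> \<Longrightarrow> y \<in> E\<^sup>\<bottom> \<Longrightarrow> x \<bullet> y \<le> c * norm x * norm y"
    and attained: "c \<noteq> 0 \<Longrightarrow>
      \<exists>x y. P x = x \<and> Q y = y \<and> x \<in> E\<^sup>\<bottom> \<and> norm x = 1 \<and> norm y = 1 \<and> x \<bullet> y = c"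
    and nontrivial: "E\<^sup>\<bottom> \<noteq> {0}"
  obtains x where "x \<in> E\<^sup>\<bottom>" "norm x = 1" "D (D x) = (1 - c\<^sup>2) *\<^sub>R x"
    "\<And>y. y \<in> E\<^sup>\<bottom> \<Longrightarrow> (1 - c\<^sup>2) * (norm y)\<^sup>2 \<le> (norm (D y))\<^sup>2" "c < 1"
proof -
  interpret D: linear D by (rule linear_D)
  obtain x \<delta> where x: "x \<in> E\<^sup>\<bottom>" "norm x = 1" "D (D x) = \<delta> *\<^sub>R x"
    and min: "\<And>y. y \<in> E\<^sup>\<bottom> \<Longrightarrow> \<delta> * (norm y)\<^sup>2 \<le> (norm (D y))\<^sup>2"
    using exists_minimal_singular_vector[OF linear_D D_sym subspace_orthogonal_comp D_mem_E_comp
        nontrivial] by metis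
  have norm_D_eigen: "(norm (D y))\<^sup>2 = \<delta> * (norm y)\<^sup>2" if "D (D y) = \<delta> *\<^sub>R y" for y
    using that D_sym[of y "D y"] by (simp add: power2_norm_eq_inner)
  have "D x \<noteq> 0" using x E_comp_nonzero[of x] by auto
  then have "\<delta> > 0"
    using norm_D_eigen[OF x(3)] x(2) zero_less_power[of "norm (D x)" 2] by simp
  have norm_QP: "(norm (D y))\<^sup>2 = (norm y)\<^sup>2 - (norm (Q y))\<^sup>2" if "P y = y" for y
    using that Q_sym[of y "Q y"] unfolding power2_norm_eq_inner
    by (simp add: D_def inner_simps inner_commute)
  have norm_PQ: "(norm (D y))\<^sup>2 = (norm y)\<^sup>2 - (norm (P y))\<^sup>2" if "Q y = y" for y
    using that P_sym[of y "P y"] unfolding power2_norm_eq_inner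
    by (simp add: D_def inner_simps inner_commute)
  \<comment> \<open>From |Q y|^2 = (y, Q y), which is at most c |y| |Q y|, one cancels |Q y|.\<close>
  have self_bound: "b\<^sup>2 \<le> c\<^sup>2 * a\<^sup>2" if "b\<^sup>2 \<le> c * a * b" "0 \<le> a" "0 \<le> b" for a b :: real
  proof (cases "b = 0")
    case False
    then have "b \<le> c * a" using that by (simp add: power2_eq_square)
    then have "b\<^sup>2 \<le> (c * a)\<^sup>2" using that by (intro power_mono) auto
    then show ?thesis by (simp add: power_mult_distrib)
  qed (use c0 that in auto)
  have "1 - \<delta> \<le> c\<^sup>2"
  proof (cases "P x = 0")
    case False
    let ?y = "P x"
    have "(norm (Q ?y))\<^sup>2 = (1 - \<delta>) * (norm ?y)\<^sup>2"
      using norm_QP[of ?y] norm_D_eigen[of ?y] x by (simp add: P_DD P.scaleR algebra_simps)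
    moreover have "(norm (Q ?y))\<^sup>2 \<le> c * norm ?y * norm (Q ?y)"
      using bound[of ?y "Q ?y"] x Q_sym[of ?y "Q ?y"]
      by (simp add: P_mem_E_comp Q_mem_E_comp power2_norm_eq_inner)
    ultimately show ?thesis using self_bound[of "norm (Q ?y)" "norm ?y"] False by simp
  next
    case True
    let ?y = "Q x"
    have "?y \<noteq> 0" using True x E_comp_nonzero[of x] by (auto simp: D_def)
    have "(norm (P ?y))\<^sup>2 = (1 - \<delta>) * (norm ?y)\<^sup>2"
      using norm_PQ[of ?y] norm_D_eigen[of ?y] x by (simp add: Q_DD Q.scaleR algebra_simps)
    moreover have "(norm (P ?y))\<^sup>2 \<le> c * norm ?y * norm (P ?y)"
      using bound[of "P ?y" ?y] x P_sym[of ?y "P ?y"]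
      by (simp add: P_mem_E_comp Q_mem_E_comp power2_norm_eq_inner P_sym algebra_simps)
    ultimately show ?thesis using self_bound[of "norm (P ?y)" "norm ?y"] \<open>?y \<noteq> 0\<close> by simp
  qed
  moreover have "c\<^sup>2 \<le> 1 - \<delta>"
  proof (cases "c = 0")
    case True
    have "\<delta> \<le> 1"
      using norm_D_eigen[OF x(3)] norm_D_le[of x] x power_le_one[of "norm (D x)" 2] by simp
    with True show ?thesis by simp
  next
    case False
    then obtain u v where uv: "P u = u" "Q v = v" "u \<in> E\<^sup>\<bottom>" "norm u = 1" "norm v = 1" "u \<bullet> v = c"
      using attained by blast
    have "c = Q u \<bullet> v" using uv Q_sym[of u v] by simp
    also have "\<dots> \<le> norm (Q u)" using norm_cauchy_schwarz[of "Q u" v] uv by simp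
    finally have "c\<^sup>2 \<le> (norm (Q u))\<^sup>2" using c0 by (intro power_mono)
    then show ?thesis using norm_QP[OF uv(1)] min[OF uv(3)] uv by simp
  qed
  ultimately have \<delta>: "\<delta> = 1 - c\<^sup>2" by simp
  then have "c\<^sup>2 < 1\<^sup>2" using \<open>\<delta> > 0\<close> by simp
  then have "c < 1" by (rule power_less_imp_less_base) simp
  show thesis
    using that[OF x(1,2)] x(3) min \<open>c < 1\<close> unfolding \<delta> by blast
qed

text \<open>
  The eigenspace of D^2 is preserved by T \<mu>, so the norm identity applies anew at each step of
  the iteration.
\<close>

lemma norm_T_iterate:
  assumes "D (D x) = (1 - c\<^sup>2) *\<^sub>R x"
    and g: "g = sqrt (\<mu> * (2 - \<mu>) * c\<^sup>2 + (1 - \<mu>)\<^sup>2)" "0 \<le> \<mu>" "\<mu> \<le> 2"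
  shows "norm ((T \<mu> ^^ k) x) = g ^ k * norm x"
proof -
  interpret T: linear "T \<mu>" by (rule linear_T)
  have g2: "g \<ge> 0" "g\<^sup>2 = \<mu> * (2 - \<mu>) * c\<^sup>2 + (1 - \<mu>)\<^sup>2" using g by auto
  have step: "norm (T \<mu> y) = g * norm y" if "D (D y) = (1 - c\<^sup>2) *\<^sub>R y" for y
  proof -
    have "(norm (D y))\<^sup>2 = (1 - c\<^sup>2) * (norm y)\<^sup>2"
      using that D_sym[of y "D y"] by (simp add: power2_norm_eq_inner)
    then have "(norm y)\<^sup>2 - (norm (D y))\<^sup>2 = c\<^sup>2 * (norm y)\<^sup>2"
      by (simp add: algebra_simps)
    then have "(norm (T \<mu> y))\<^sup>2 = (g * norm y)\<^sup>2"
      unfolding norm_T power_mult_distrib g2 by (simp add: distrib_right)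
    then show ?thesis using g2 by simp
  qed
  have "D (D ((T \<mu> ^^ k) x)) = (1 - c\<^sup>2) *\<^sub>R (T \<mu> ^^ k) x \<and> norm ((T \<mu> ^^ k) x) = g ^ k * norm x"
  proof (induction k)
    case (Suc k)
    let ?y = "(T \<mu> ^^ k) x"
    have y: "D (D ?y) = (1 - c\<^sup>2) *\<^sub>R ?y" using Suc by blast
    then have "D (D (T \<mu> ?y)) = (1 - c\<^sup>2) *\<^sub>R T \<mu> ?y"
      by (simp only: T_DD T.scaleR)
    with step[OF y] Suc show ?case by simp
  qed (use assms in simp)
  then show ?thesis by simp
qed

lemma norm_T_le:
  assumes "(1 - c\<^sup>2) * (norm x)\<^sup>2 \<le> (norm (D x))\<^sup>2" and "0 \<le> \<mu>" "\<mu> \<le> 2"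
  shows "norm (T \<mu> x) \<le> sqrt (\<mu> * (2 - \<mu>) * c\<^sup>2 + (1 - \<mu>)\<^sup>2) * norm x"
proof -
  have "\<mu> * (2 - \<mu>) * ((norm x)\<^sup>2 - (norm (D x))\<^sup>2) \<le> \<mu> * (2 - \<mu>) * (c\<^sup>2 * (norm x)\<^sup>2)"
    using assms(1) assms(2,3) by (intro mult_left_mono mult_nonneg_nonneg) (simp_all add: left_diff_distrib)
  then have "(norm (T \<mu> x))\<^sup>2 \<le> (sqrt (\<mu> * (2 - \<mu>) * c\<^sup>2 + (1 - \<mu>)\<^sup>2) * norm x)\<^sup>2"
    unfolding norm_T power_mult_distrib using assms(2,3) by (simp add: distrib_right)
  then show ?thesis by (rule power2_le_imp_le) (use assms(2,3) in simp)
qed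

text \<open>
  On the eigenspace of D^2 for 1 - c^2 the quadratic equation of R becomes R^2 = 2 c^2 R - c^2, and
  for nonzero \<mu> the substitution R = (T \<mu> - (1 - \<mu>) Id) / \<mu> turns it into the equation of T \<mu>. Its constant term is
  the square of the factor by which T \<mu> changes norms.
\<close>

lemma T_quadratic:
  assumes "D (D x) = (1 - c\<^sup>2) *\<^sub>R x"
  shows "T \<mu> (T \<mu> x) = (2 * (1 - \<mu> + \<mu> * c\<^sup>2)) *\<^sub>R T \<mu> x - (\<mu> * (2 - \<mu>) * c\<^sup>2 + (1 - \<mu>)\<^sup>2) *\<^sub>R x"
proof -
  have "R = T 1" by (auto simp: T_def)
  then have "linear R" by (simp add: linear_T)
  then interpret R: linear R .
  have "D (D (R x)) = (1 - c\<^sup>2) *\<^sub>R R x"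
    using T_DD[of 1 x] assms by (simp add: T_def R.scaleR)
  then have "R (R x) = (2 * c\<^sup>2) *\<^sub>R R x - c\<^sup>2 *\<^sub>R x"
    unfolding R_quadratic assms by (simp add: scaleR_left_diff_distrib)
  then have RR: "R (R x) \<bullet> b = 2 * c\<^sup>2 * (R x \<bullet> b) - c\<^sup>2 * (x \<bullet> b)" for b
    by (simp only: inner_diff_left inner_scaleR_left)
  show ?thesis
  proof (rule euclidean_eqI)
    fix b :: 'a
    have "T \<mu> (T \<mu> x) \<bullet> b
        = (1 - \<mu>) * ((1 - \<mu>) * (x \<bullet> b) + \<mu> * (R x \<bullet> b))
          + \<mu> * ((1 - \<mu>) * (R x \<bullet> b) + \<mu> * (R (R x) \<bullet> b))"
      by (simp only: T_def R.add R.scaleR inner_add_left inner_scaleR_left)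
    also have "\<dots> = 2 * (1 - \<mu> + \<mu> * c\<^sup>2) * ((1 - \<mu>) * (x \<bullet> b) + \<mu> * (R x \<bullet> b))
        - (\<mu> * (2 - \<mu>) * c\<^sup>2 + (1 - \<mu>)\<^sup>2) * (x \<bullet> b)"
      unfolding RR by algebra
    also have "\<dots> = ((2 * (1 - \<mu> + \<mu> * c\<^sup>2)) *\<^sub>R T \<mu> x
        - (\<mu> * (2 - \<mu>) * c\<^sup>2 + (1 - \<mu>)\<^sup>2) *\<^sub>R x) \<bullet> b"
      by (simp only: T_def inner_add_left inner_diff_left inner_scaleR_left)
    finally show "T \<mu> (T \<mu> x) \<bullet> b = ((2 * (1 - \<mu> + \<mu> * c\<^sup>2)) *\<^sub>R T \<mu> x
        - (\<mu> * (2 - \<mu>) * c\<^sup>2 + (1 - \<mu>)\<^sup>2) *\<^sub>R x) \<bullet> b" .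
  qed
qed

text \<open>
  For \<mu> outside (0,2) the coefficient of |D x|^2 in the norm identity is nonnegative,
  and without that term the right-hand side is |x|^2.
\<close>

lemma norm_T_ge:
  assumes "\<mu> \<notin> {0<..<2}"
  shows "norm x \<le> norm (T \<mu> x)"
proof -
  have "\<mu> * (2 - \<mu>) \<le> 0" using assms by (auto simp: mult_le_0_iff)
  then have "\<mu> * (2 - \<mu>) * (norm (D x))\<^sup>2 \<le> 0" by (simp add: mult_nonpos_nonneg)
  then have "(norm x)\<^sup>2 \<le> (norm (T \<mu> x))\<^sup>2"
    unfolding norm_T by (simp add: power2_eq_square algebra_simps)
  then show ?thesis by (rule power2_le_imp_le) simp
qed

end

section \<open>Projection matrices\<close>

lemma orthogonal_compD: "x \<in> W\<^sup>\<bottom> \<Longrightarrow> y \<in> W \<Longrightarrow> x \<bullet> y = 0" "x \<in> W\<^sup>\<bottom> \<Longrightarrow> y \<in> W \<Longrightarrow> y \<bullet> x = 0"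
  by (auto simp: orthogonal_comp_def orthogonal_def inner_commute)

lemma orthogonal_compI: "(\<And>y. y \<in> W \<Longrightarrow> x \<bullet> y = 0) \<Longrightarrow> x \<in> W\<^sup>\<bottom>"
  by (auto simp: orthogonal_comp_def orthogonal_def inner_commute)

lemma orthogonal_comp_Int_self: "x \<in> W \<Longrightarrow> x \<in> W\<^sup>\<bottom> \<Longrightarrow> x = 0"
  by (auto simp: orthogonal_comp_def orthogonal_def)

lemma orthogonal_decomp_unique:
  assumes "subspace W" "y \<in> W" "x - y \<in> W\<^sup>\<bottom>" "z \<in> W" "x - z \<in> W\<^sup>\<bottom>"
  shows "y = z"
proof -
  have "y - z \<in> W" using assms by (simp add: subspace_diff)
  moreover have "(x - z) - (x - y) \<in> W\<^sup>\<bottom>"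
    using assms(5,3) by (rule subspace_diff[OF subspace_orthogonal_comp])
  ultimately show ?thesis
    using orthogonal_comp_Int_self[of "y - z" W] by simp
qed

lemma proj_mat_works:
  fixes W :: "(real^'n) set"
  assumes W: "subspace W"
  shows "proj_mat W *v x \<in> W" and "x - proj_mat W *v x \<in> W\<^sup>\<bottom>"
proof -
  define p where "p x = (THE y. y \<in> W \<and> x - y \<in> W\<^sup>\<bottom>)" for x
  have ex: "\<exists>y. y \<in> W \<and> x - y \<in> W\<^sup>\<bottom>" for x
  proof -
    obtain y z where "y \<in> span W" "\<And>w. w \<in> span W \<Longrightarrow> orthogonal z w" "x = y + z"
      using orthogonal_subspace_decomp_exists[of W x] by metis
    then show ?thesis
      using W by (intro exI[of _ y])
        (auto simp: orthogonal_comp_def orthogonal_commute span_eq_iff[THEN iffD2, OF W])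
  qed
  have p_eq: "p x = y" if "y \<in> W" "x - y \<in> W\<^sup>\<bottom>" for x y
    unfolding p_def using that orthogonal_decomp_unique[OF W] by blast
  have p: "p x \<in> W" "x - p x \<in> W\<^sup>\<bottom>" for x
    using ex[of x] p_eq[of _ x] by auto
  have "linear p"
  proof (rule linearI)
    fix x y
    have "(x - p x) + (y - p y) \<in> W\<^sup>\<bottom>"
      using p by (intro subspace_add subspace_orthogonal_comp)
    then show "p (x + y) = p x + p y"
      using p W by (intro p_eq) (auto simp: subspace_add algebra_simps)
  next
    fix c x
    have "c *\<^sub>R (x - p x) \<in> W\<^sup>\<bottom>"
      using p by (intro subspace_scale subspace_orthogonal_comp)
    then show "p (c *\<^sub>R x) = c *\<^sub>R p x"
      using p W by (intro p_eq) (auto simp: subspace_scale algebra_simps)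
  qed
  then have "proj_mat W *v x = p x" for x
    unfolding proj_mat_def p_def[abs_def] by (simp add: matrix_works linear_matrix_vector_mul_eq)
  with p show "proj_mat W *v x \<in> W" and "x - proj_mat W *v x \<in> W\<^sup>\<bottom>"
    by simp_all
qed

lemma proj_mat_eqI:
  assumes "subspace W" "y \<in> W" "x - y \<in> W\<^sup>\<bottom>"
  shows "proj_mat W *v x = y"
  using orthogonal_decomp_unique[OF assms(1)] proj_mat_works[OF assms(1)] assms by blast

lemma proj_mat_fixed_iff: "subspace W \<Longrightarrow> proj_mat W *v x = x \<longleftrightarrow> x \<in> W"
  using proj_mat_eqI[of W x x] proj_mat_works(1)[of W x] by (auto simp: orthogonal_comp_def orthogonal_def)

lemma proj_mat_zero_iff: "subspace W \<Longrightarrow> proj_mat W *v x = 0 \<longleftrightarrow> x \<in> W\<^sup>\<bottom>"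
  using proj_mat_eqI[of W 0 x] proj_mat_works(2)[of W x] by (auto simp: subspace_0)

lemma proj_mat_orthogonal_comp:
  assumes "subspace W"
  shows "proj_mat (W\<^sup>\<bottom>) *v x = x - proj_mat W *v x"
  using proj_mat_works[OF assms, of x] orthogonal_comp_self[OF assms]
  by (intro proj_mat_eqI subspace_orthogonal_comp) auto

lemma proj_mat_sym:
  assumes "subspace W"
  shows "(proj_mat W *v x) \<bullet> y = x \<bullet> (proj_mat W *v y)"
proof -
  have "(proj_mat W *v x) \<bullet> (y - proj_mat W *v y) = 0" "(x - proj_mat W *v x) \<bullet> (proj_mat W *v y) = 0"
    using proj_mat_works[OF assms] orthogonal_compD by blast+
  then show ?thesis by (simp add: inner_simps)
qed

lemma transpose_proj_mat: "subspace W \<Longrightarrow> transpose (proj_mat W) = proj_mat W"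
  unfolding matrix_eq
proof (intro allI)
  fix x assume W: "subspace W"
  show "transpose (proj_mat W) *v x = proj_mat W *v x"
  proof (rule vector_eq_ldot[THEN iffD1], intro allI)
    fix y
    show "y \<bullet> (transpose (proj_mat W) *v x) = y \<bullet> (proj_mat W *v x)"
      using proj_mat_sym[OF W, of y x] by (simp add: inner_commute[of y] dot_lmul_matrix inner_commute[of x])
  qed
qed

lemma two_projections_proj_mat:
  assumes "subspace U" "subspace V"
  shows "two_projections ((*v) (proj_mat U)) ((*v) (proj_mat V))"
  using assms
  by unfold_locales (auto simp: matrix_vector_right_distrib matrix_vector_mult_scaleR
      proj_mat_fixed_iff proj_mat_works proj_mat_sym)

lemma dr_mat_vector_mult:
  assumes "subspace U" "subspace V"
  shows "dr_mat U V *v x = x - proj_mat U *v x - proj_mat V *v x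
    + 2 *\<^sub>R (proj_mat U *v (proj_mat V *v x))"
  using assms
  by (simp add: dr_mat_def matrix_vector_mult_add_rdistrib proj_mat_orthogonal_comp scaleR_2
      matrix_vector_mult_diff_distrib flip: matrix_vector_mul_assoc)

lemma relaxed_dr_mat_vector_mult:
  "relaxed_dr_mat U V \<mu> *v x = (1 - \<mu>) *\<^sub>R x + \<mu> *\<^sub>R (dr_mat U V *v x)"
  by (simp add: relaxed_dr_mat_def matrix_vector_mult_add_rdistrib flip: scaleR_matrix_vector_assoc)

section \<open>Convergence rates of matrix powers\<close>

lemma opnorm_le: "(\<And>x. norm (A *v x) \<le> b * norm x) \<Longrightarrow> opnorm A \<le> b"
  unfolding opnorm_def by (rule onorm_le)

lemma norm_le_opnorm: "norm (A *v x) \<le> opnorm A * norm x"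
  unfolding opnorm_def by (rule onorm) simp

lemma opnorm_nonneg: "0 \<le> opnorm A"
  unfolding opnorm_def by (rule onorm_pos_le) simp

lemma matpow_vector_mult: "matpow A k *v x = (((*v) A) ^^ k) x"
  by (induction k) (auto simp flip: matrix_vector_mul_assoc)

lemma conv_rate_imp_convergent:
  assumes "is_conv_rate A L r"
  shows "mat_convergent_to A L"
proof -
  from assms obtain M N where r: "0 \<le> r" "r < 1"
    and bound: "\<And>k. k > N \<Longrightarrow> opnorm (matpow A k - L) \<le> M * r ^ k"
    unfolding is_conv_rate_def by blast
  have limit: "(\<lambda>k. M * r ^ k) \<longlonglongrightarrow> 0"
    using r by (intro tendsto_mult_right_zero LIMSEQ_power_zero) simp
  have upper: "\<forall>\<^sub>F k in sequentially. opnorm (matpow A k - L) \<le> M * r ^ k"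
    using eventually_gt_at_top[of N] by eventually_elim (rule bound)
  have lower: "\<forall>\<^sub>F k in sequentially. 0 \<le> opnorm (matpow A k - L)"
    by (simp add: opnorm_nonneg)
  show ?thesis
    unfolding mat_convergent_to_def
    by (rule tendsto_sandwich[OF lower upper tendsto_const limit])
qed

text \<open>
  The increments of the powers applied to x are the images of A x - x under powers of A. They
  tend to 0, yet A does not shorten them, so the first one is 0.
\<close>

lemma expanding_convergent_imp_identity:
  assumes expanding: "\<And>x. norm x \<le> norm (A *v x)" and "mat_convergent A"
  shows "A *v x = x"
proof -
  obtain L where L: "(\<lambda>k. opnorm (matpow A k - L)) \<longlonglongrightarrow> 0"
    using assms(2) unfolding mat_convergent_def mat_convergent_to_def by blast
  have "(\<lambda>k. norm ((matpow A k - L) *v x)) \<longlonglongrightarrow> 0"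
    by (rule tendsto_sandwich[OF _ _ tendsto_const tendsto_mult_left_zero[OF L, of "norm x"]])
       (auto simp: norm_le_opnorm)
  then have lim: "(\<lambda>k. matpow A k *v x) \<longlonglongrightarrow> L *v x"
    by (simp add: tendsto_norm_zero_iff matrix_vector_mult_diff_rdistrib LIM_zero_iff)
  have "(\<lambda>k. matpow A (Suc k) *v x - matpow A k *v x) \<longlonglongrightarrow> L *v x - L *v x"
    by (intro tendsto_diff lim LIMSEQ_Suc)
  then have "(\<lambda>k. norm (matpow A (Suc k) *v x - matpow A k *v x)) \<longlonglongrightarrow> 0"
    by (simp add: tendsto_norm_zero_iff)
  moreover have "norm (A *v x - x) \<le> norm (matpow A (Suc k) *v x - matpow A k *v x)" for k
  proof (induction k)
    case (Suc k)
    also have "norm (matpow A (Suc k) *v x - matpow A k *v x)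
        \<le> norm (A *v (matpow A (Suc k) *v x - matpow A k *v x))"
      by (rule expanding)
    also have "A *v (matpow A (Suc k) *v x - matpow A k *v x)
        = matpow A (Suc (Suc k)) *v x - matpow A (Suc k) *v x"
      by (simp add: matrix_vector_mult_diff_distrib flip: matrix_vector_mul_assoc)
    finally show ?case .
  qed simp
  ultimately have "norm (A *v x - x) \<le> 0"
    by (intro tendsto_lowerbound) auto
  then show ?thesis by simp
qed

text \<open>
  On F both A and the limit are the identity, so only the complement of F contributes and the
  contraction factor g is a rate. The vector whose norm shrinks exactly by g at each step rules out
  any smaller rate. For g = 0 optimality is automatic, because rates are nonnegative.
\<close>

lemma optimal_conv_rateI:
  fixes A :: "real^'n^'n"
  assumes F: "subspace F" and fixes_F: "\<And>x. x \<in> F \<Longrightarrow> A *v x = x"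
    and invariant: "\<And>x. x \<in> F\<^sup>\<bottom> \<Longrightarrow> A *v x \<in> F\<^sup>\<bottom>"
    and contraction: "\<And>x. x \<in> F\<^sup>\<bottom> \<Longrightarrow> norm (A *v x) \<le> g * norm x"
    and g: "0 \<le> g" "g < 1"
    and sharp: "g \<noteq> 0 \<Longrightarrow> \<exists>x\<in>F\<^sup>\<bottom>. x \<noteq> 0 \<and> (\<forall>k. norm (matpow A k *v x) = g ^ k * norm x)"
  shows "is_optimal_conv_rate A (proj_mat F) g"
proof -
  have pow_F: "matpow A k *v x = x" if "x \<in> F" for k x
    by (induction k) (auto simp: fixes_F[OF that] simp flip: matrix_vector_mul_assoc)
  have pow_comp: "matpow A k *v x \<in> F\<^sup>\<bottom> \<and> norm (matpow A k *v x) \<le> g ^ k * norm x" if "x \<in> F\<^sup>\<bottom>" for k x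
  proof (induction k)
    case (Suc k)
    let ?y = "matpow A k *v x"
    have "norm (A *v ?y) \<le> g * norm ?y"
      using contraction Suc by blast
    also have "\<dots> \<le> g * (g ^ k * norm x)"
      using Suc g by (intro mult_left_mono) auto
    finally show ?case
      using invariant[of ?y] Suc by (simp add: mult.assoc flip: matrix_vector_mul_assoc)
  qed (use that in simp)
  have diff_eq: "(matpow A k - proj_mat F) *v x = matpow A k *v (x - proj_mat F *v x)" for k x
    by (simp add: matrix_vector_mult_diff_rdistrib matrix_vector_mult_diff_distrib
        pow_F proj_mat_works[OF F])
  have "opnorm (matpow A k - proj_mat F) \<le> g ^ k" for k
  proof (rule opnorm_le)
    fix x
    let ?z = "x - proj_mat F *v x"
    have "?z \<bullet> (proj_mat F *v x) = 0"
      using proj_mat_works[OF F, of x] by (rule orthogonal_compD(1)[rotated])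
    then have "(norm (?z + proj_mat F *v x))\<^sup>2 = (norm ?z)\<^sup>2 + (norm (proj_mat F *v x))\<^sup>2"
      by (intro norm_add_Pythagorean) (simp add: orthogonal_def)
    then have "(norm ?z)\<^sup>2 \<le> (norm x)\<^sup>2" by simp
    then have "norm ?z \<le> norm x" by (rule power2_le_imp_le) simp
    then have "g ^ k * norm ?z \<le> g ^ k * norm x"
      using g by (intro mult_left_mono) auto
    with pow_comp[OF proj_mat_works(2)[OF F], of k x]
    show "norm ((matpow A k - proj_mat F) *v x) \<le> g ^ k * norm x"
      unfolding diff_eq by linarith
  qed
  then have rate: "is_conv_rate A (proj_mat F) g"
    unfolding is_conv_rate_def using g by (auto intro!: exI[of _ "1::real"] exI[of _ "1::nat"])
  have lower: "g \<le> r" if r: "is_conv_rate A (proj_mat F) r" for r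
  proof (cases "g = 0")
    case True
    with r show ?thesis by (simp add: is_conv_rate_def)
  next
    case False
    then obtain x where x: "x \<in> F\<^sup>\<bottom>" "x \<noteq> 0" "\<And>k. norm (matpow A k *v x) = g ^ k * norm x"
      using sharp by blast
    from r obtain M N where "0 \<le> r" "M > 0"
      and bound: "\<And>k. k > N \<Longrightarrow> opnorm (matpow A k - proj_mat F) \<le> M * r ^ k"
      unfolding is_conv_rate_def by blast
    have gM: "g ^ k \<le> M * r ^ k" if "k > N" for k
    proof -
      have "g ^ k * norm x = norm ((matpow A k - proj_mat F) *v x)"
        using x proj_mat_zero_iff[OF F, of x] by (simp add: diff_eq)
      also have "\<dots> \<le> M * r ^ k * norm x"
        using norm_le_opnorm[of "matpow A k - proj_mat F" x] bound[OF that]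
        by (meson mult_right_mono norm_ge_zero order_trans)
      finally show ?thesis using x by simp
    qed
    show ?thesis
    proof (rule ccontr)
      assume "\<not> g \<le> r"
      \<comment> \<open>If r < g, then M (r/g)^k drops below 1, although g^k is at most M r^k.\<close>
      then have "\<bar>r / g\<bar> < 1" using \<open>0 \<le> r\<close> g by simp
      then have "(\<lambda>k. M * (r / g) ^ k) \<longlonglongrightarrow> 0"
        by (intro tendsto_mult_right_zero LIMSEQ_power_zero) simp
      then have "\<forall>\<^sub>F k in sequentially. M * (r / g) ^ k < 1"
        by (rule order_tendstoD) simp
      then have "\<forall>\<^sub>F k in sequentially. M * (r / g) ^ k < 1 \<and> k > N"
        using eventually_gt_at_top by (rule eventually_conj)
      then obtain k where k: "M * (r / g) ^ k < 1" "k > N"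
        using eventually_happens'[OF sequentially_bot] by blast
      have "g ^ k > 0" using False g by simp
      with k gM[of k] show False by (simp add: power_divide field_simps)
    qed
  qed
  then have "Inf {r. is_conv_rate A (proj_mat F) r} = g"
    using rate by (intro cInf_eq_minimum) auto
  with rate show ?thesis by (simp add: is_optimal_conv_rate_def)
qed

section \<open>Eigenvalues of real matrices\<close>

text \<open>
  Eigenvectors for distinct eigenvalues are independent, in the form needed for induction on L: if v
  lies in the span of the given eigenvectors, then applying A - m Id removes the component along f m and
  multiplies v by l - m, so (l - m) v is an eigenvector for l in a smaller span.
\<close>

lemma eigenvector_of_other_eigenvalue_in_span:
  fixes A :: "'a::field^'n^'n"
  assumes "finite L" and "\<And>m. m \<in> L \<Longrightarrow> A *v f m = m *s f m"
    and "v \<in> vec.span (f ` L)" and "A *v v = l *s v" and "l \<notin> L"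
  shows "v = 0"
  using assms
proof (induction L arbitrary: v rule: finite_induct)
  case (insert m L)
  have invariant: "A *v w \<in> vec.span (f ` L)" if "w \<in> vec.span (f ` L)" for w
    using that
  proof (induction rule: vec.span_induct_alt)
    case (step c x y)
    then obtain j where "j \<in> L" "x = f j" by blast
    then have "A *v x = j *s x" "x \<in> vec.span (f ` L)"
      using insert.prems(1) by (auto intro: vec.span_base)
    then have "A *v x \<in> vec.span (f ` L)" by (simp add: vec.span_scale)
    with step show ?case
      by (simp add: vec.add vec.scale vec.span_add vec.span_scale)
  qed (simp add: vec.span_zero)
  obtain k where k: "v - k *s f m \<in> vec.span (f ` L)"
    using insert.prems(2) by (auto simp: vec.span_breakdown_eq)
  have "(l - m) *s v = A *v (v - k *s f m) - m *s (v - k *s f m)"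
    using insert.prems by (simp add: vec.diff vec.scale vec.scale_left_diff_distrib
        vec.scale_right_diff_distrib mult.commute)
  also have "\<dots> \<in> vec.span (f ` L)"
    by (rule vec.span_diff[OF invariant[OF k] vec.span_scale[OF k]])
  finally have "(l - m) *s v \<in> vec.span (f ` L)" .
  moreover have "A *v ((l - m) *s v) = l *s ((l - m) *s v)"
    by (simp only: vec.scale insert.prems(3) vec.scale_scale mult.commute)
  ultimately have "(l - m) *s v = 0"
    using insert.prems by (intro insert.IH) auto
  then show ?case using insert.prems by auto
qed simp

text \<open>
  Finiteness is what gives the maximum in the definition of gamma_mat its meaning.
\<close>

lemma finite_eigvals:
  fixes A :: "real^'n^'n"
  shows "finite (eigvals A)"
proof -
  let ?B = "map_matrix complex_of_real A"
  have "\<forall>z\<in>eigvals A. \<exists>w. w \<noteq> 0 \<and> ?B *v w = z *s w"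
    by (simp add: eigvals_def)
  from bchoice[OF this] obtain f
    where f: "\<forall>z\<in>eigvals A. f z \<noteq> 0 \<and> ?B *v f z = z *s f z" ..
  have inj: "inj_on f (eigvals A)"
  proof (rule inj_onI)
    fix l m assume lm: "l \<in> eigvals A" "m \<in> eigvals A" "f l = f m"
    have l: "?B *v f l = l *s f l" "f l \<noteq> 0" and m: "?B *v f m = m *s f m"
      using f lm by blast+
    have "l *s f l = m *s f l"
      using l(1) m unfolding lm(3) by (rule trans[OF sym])
    with l(2) show "l = m" by (simp only: vec.scale_cancel_right simp_thms)
  qed
  have indep: "vec.independent (f ` L)" if "finite L" "L \<subseteq> eigvals A" for L
    using that
  proof (induction L rule: finite_induct)
    case (insert l L)
    have "f l \<notin> vec.span (f ` L)"
      using eigenvector_of_other_eigenvalue_in_span[of L ?B f "f l" l] insert f by blast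
    with insert show ?case by (simp add: vec.independent_insertI)
  qed (simp add: vec.independent_empty)
  have card_le: "card (f ` L) \<le> vec.dim (UNIV :: (complex^'n) set)" if "L \<subseteq> eigvals A" "finite L" for L
    by (rule vec.independent_card_le_dim[OF subset_UNIV indep[OF that(2,1)]])
  have "card L \<le> vec.dim (UNIV :: (complex^'n) set)" if "L \<subseteq> eigvals A" "finite L" for L
    using card_le[OF that] unfolding card_image[OF inj_on_subset[OF inj that(1)]] .
  then show ?thesis
    by (intro conjunct1[OF finite_if_finite_subsets_card_bdd])
qed

text \<open>
  Separating a complex eigenvector into real and imaginary part keeps all norm estimates over the
  reals.
\<close>

lemma eigvals_iff_real:
  fixes A :: "real^'n^'n"
  shows "z \<in> eigvals A \<longleftrightarrow> (\<exists>x y. (x \<noteq> 0 \<or> y \<noteq> 0) \<and>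
     A *v x = Re z *\<^sub>R x - Im z *\<^sub>R y \<and> A *v y = Re z *\<^sub>R y + Im z *\<^sub>R x)"
  (is "_ \<longleftrightarrow> (\<exists>x y. ?eig x y)")
proof -
  let ?B = "map_matrix complex_of_real A"
  define re im :: "complex^'n \<Rightarrow> real^'n"
    where "re w = (\<chi> i. Re (w $ i))" and "im w = (\<chi> i. Im (w $ i))" for w
  have "?B *v w = z *s w \<longleftrightarrow> A *v re w = Re z *\<^sub>R re w - Im z *\<^sub>R im w \<and>
      A *v im w = Re z *\<^sub>R im w + Im z *\<^sub>R re w" for w
    by (auto simp: re_def im_def vec_eq_iff complex_eq_iff matrix_vector_mult_def Re_sum Im_sum)
  moreover have "w \<noteq> 0 \<longleftrightarrow> re w \<noteq> 0 \<or> im w \<noteq> 0" for w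
    by (auto simp: re_def im_def vec_eq_iff complex_eq_iff)
  ultimately have eig: "w \<noteq> 0 \<and> ?B *v w = z *s w \<longleftrightarrow> ?eig (re w) (im w)" for w by blast
  show ?thesis
  proof
    assume "z \<in> eigvals A"
    then show "\<exists>x y. ?eig x y" unfolding eigvals_def using eig by blast
  next
    assume "\<exists>x y. ?eig x y"
    then obtain x y where xy: "?eig x y" by blast
    define w where "w = (\<chi> i. Complex (x $ i) (y $ i))"
    have "re w = x" "im w = y" by (simp_all add: re_def im_def w_def)
    with xy eig[of w] show "z \<in> eigvals A" unfolding eigvals_def by blast
  qed
qed

text \<open>
  The quadratic relation factors as (A - z Id) (A - z' Id) x = 0 with z = a + i b and its conjugate
  z'. Hence (A - z' Id) x, with real part A x - a x and imaginary part b x, is an eigenvector for z, unless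
  it vanishes; in that case b = 0 and x itself is one.
\<close>

lemma eigval_of_quadratic_relation:
  assumes "x \<noteq> 0" and quad: "A *v (A *v x) = (2 * a) *\<^sub>R (A *v x) - (a\<^sup>2 + b\<^sup>2) *\<^sub>R x"
  shows "Complex a b \<in> eigvals A"
proof (cases "b = 0 \<and> A *v x = a *\<^sub>R x")
  case True
  with \<open>x \<noteq> 0\<close> show ?thesis
    unfolding eigvals_iff_real by (intro exI[of _ x] exI[of _ 0]) simp
next
  case False
  then have "A *v x - a *\<^sub>R x \<noteq> 0 \<or> b *\<^sub>R x \<noteq> 0" using \<open>x \<noteq> 0\<close> by auto
  moreover have "A *v (A *v x - a *\<^sub>R x) = a *\<^sub>R (A *v x - a *\<^sub>R x) - b *\<^sub>R (b *\<^sub>R x)"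
    unfolding matrix_vector_mult_diff_distrib matrix_vector_mult_scaleR quad mult_2 scaleR_add_left
    by (simp add: algebra_simps power2_eq_square)
  moreover have "A *v (b *\<^sub>R x) = a *\<^sub>R (b *\<^sub>R x) + b *\<^sub>R (A *v x - a *\<^sub>R x)"
    by (simp add: matrix_vector_mult_scaleR algebra_simps)
  ultimately show ?thesis
    unfolding eigvals_iff_real complex.sel by blast
qed

text \<open>
  The projection p onto F satisfies p A = p, so that p w = z p w for an eigenvector w for z.
  As z is not 1, both real and imaginary part of w lie in the complement of F, where A contracts.
\<close>

lemma eigval_norm_le:
  fixes A :: "real^'n^'n"
  assumes F: "subspace F" and fixes_F: "\<And>x. x \<in> F \<Longrightarrow> A *v x = x"
    and invariant: "\<And>x. x \<in> F\<^sup>\<bottom> \<Longrightarrow> A *v x \<in> F\<^sup>\<bottom>"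
    and contraction: "\<And>x. x \<in> F\<^sup>\<bottom> \<Longrightarrow> norm (A *v x) \<le> g * norm x" and "0 \<le> g"
    and z: "z \<in> eigvals A" "z \<noteq> 1"
  shows "cmod z \<le> g"
proof -
  let ?p = "\<lambda>x. proj_mat F *v x"
  define a b where "a = Re z" and "b = Im z"
  obtain x y where nz: "x \<noteq> 0 \<or> y \<noteq> 0"
    and Ax: "A *v x = a *\<^sub>R x - b *\<^sub>R y" and Ay: "A *v y = a *\<^sub>R y + b *\<^sub>R x"
    using z(1) unfolding eigvals_iff_real a_def b_def by blast
  have pA: "?p (A *v w) = ?p w" for w
  proof (rule proj_mat_eqI[OF F])
    have "A *v w - ?p w = A *v (w - ?p w)"
      by (simp add: matrix_vector_mult_diff_distrib fixes_F proj_mat_works[OF F])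
    then show "A *v w - ?p w \<in> F\<^sup>\<bottom>"
      using invariant proj_mat_works[OF F] by simp
  qed (rule proj_mat_works[OF F])
  \<comment> \<open>The equation p w = z p w for w = x + i y, solved by elimination.\<close>
  have px: "(1 - a) *\<^sub>R ?p x = - (b *\<^sub>R ?p y)" and py: "(1 - a) *\<^sub>R ?p y = b *\<^sub>R ?p x"
    using pA[of x] pA[of y] unfolding Ax Ay
    by (simp_all add: matrix_vector_mult_diff_distrib matrix_vector_right_distrib
        matrix_vector_mult_scaleR algebra_simps)
  have "((1 - a)\<^sup>2 + b\<^sup>2) *\<^sub>R ?p x = (1 - a) *\<^sub>R ((1 - a) *\<^sub>R ?p x) + b *\<^sub>R (b *\<^sub>R ?p x)"
    by (simp add: power2_eq_square scaleR_add_left)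
  also have "\<dots> = b *\<^sub>R (b *\<^sub>R ?p x - (1 - a) *\<^sub>R ?p y)"
    unfolding px by (simp add: scaleR_diff_right mult.commute)
  also have "\<dots> = 0" unfolding py by simp
  finally have x0: "((1 - a)\<^sup>2 + b\<^sup>2) *\<^sub>R ?p x = 0" .
  have "((1 - a)\<^sup>2 + b\<^sup>2) *\<^sub>R ?p y = (1 - a) *\<^sub>R ((1 - a) *\<^sub>R ?p y) + b *\<^sub>R (b *\<^sub>R ?p y)"
    by (simp add: power2_eq_square scaleR_add_left)
  also have "\<dots> = b *\<^sub>R ((1 - a) *\<^sub>R ?p x + b *\<^sub>R ?p y)"
    unfolding py by (simp add: scaleR_add_right mult.commute)
  also have "\<dots> = 0" unfolding px by simp
  finally have y0: "((1 - a)\<^sup>2 + b\<^sup>2) *\<^sub>R ?p y = 0" .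
  have "(1 - a)\<^sup>2 + b\<^sup>2 \<noteq> 0"
    using z(2) by (auto simp: a_def b_def complex_eq_iff sum_power2_eq_zero_iff)
  with x0 y0 have "x \<in> F\<^sup>\<bottom>" "y \<in> F\<^sup>\<bottom>"
    by (simp_all only: scaleR_eq_0_iff proj_mat_zero_iff[OF F] simp_thms)
  then have "(norm (A *v x))\<^sup>2 \<le> (g * norm x)\<^sup>2" "(norm (A *v y))\<^sup>2 \<le> (g * norm y)\<^sup>2"
    by (auto intro!: power_mono contraction)
  moreover have "(norm (A *v x))\<^sup>2 + (norm (A *v y))\<^sup>2 = (cmod z)\<^sup>2 * ((norm x)\<^sup>2 + (norm y)\<^sup>2)"
    unfolding Ax Ay cmod_power2 a_def[symmetric] b_def[symmetric] power2_norm_eq_inner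
    by (simp add: inner_simps inner_commute power2_eq_square algebra_simps)
  ultimately have "(cmod z)\<^sup>2 * ((norm x)\<^sup>2 + (norm y)\<^sup>2) \<le> g\<^sup>2 * ((norm x)\<^sup>2 + (norm y)\<^sup>2)"
    by (simp add: power_mult_distrib distrib_left)
  moreover have "0 < (norm x)\<^sup>2 + (norm y)\<^sup>2"
    using nz by (simp add: sum_power2_gt_zero_iff)
  ultimately have "(cmod z)\<^sup>2 \<le> g\<^sup>2" by (rule mult_right_le_imp_le)
  then show ?thesis using \<open>0 \<le> g\<close> by (rule power2_le_imp_le)
qed

lemma gamma_mat_eqI:
  assumes "0 \<le> g" "g < 1" and le: "\<And>z. z \<in> eigvals A \<Longrightarrow> z \<noteq> 1 \<Longrightarrow> cmod z \<le> g"
    and attained: "g \<noteq> 0 \<Longrightarrow> \<exists>z\<in>eigvals A. cmod z = g"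
  shows "gamma_mat A = g"
  unfolding gamma_mat_def
proof (rule Max_eqI)
  show "finite (cmod ` (insert 0 (eigvals A) - {1}))" by (simp add: finite_eigvals)
  show "g \<in> cmod ` (insert 0 (eigvals A) - {1})"
  proof (cases "g = 0")
    case False
    then obtain z where z: "z \<in> eigvals A" "cmod z = g" using attained by blast
    then have "z \<in> insert 0 (eigvals A) - {1}" using \<open>g < 1\<close> by auto
    then show ?thesis unfolding z(2)[symmetric] by (rule imageI)
  qed auto
qed (use assms in auto)

section \<open>Principal angles and the Friedrichs angle\<close>

lemma unit_vector_in_relative_complement:
  fixes W X :: "(real^'n) set"
  assumes "subspace W" "subspace X" "W \<subseteq> X" "W \<noteq> X"
  obtains x where "x \<in> X" "x \<in> W\<^sup>\<bottom>" "norm x = 1"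
proof -
  obtain z where z: "z \<in> X" "z \<notin> W" using assms by blast
  let ?y = "z - proj_mat W *v z"
  have y: "?y \<in> X" "?y \<in> W\<^sup>\<bottom>"
    using assms z proj_mat_works[OF assms(1), of z] by (auto intro: subspace_diff)
  have "?y \<noteq> 0"
    using z proj_mat_fixed_iff[OF assms(1), of z] by (simp only: right_minus_eq) metis
  then show thesis
    using y assms(2)
    by (intro that[of "inverse (norm ?y) *\<^sub>R ?y"]) (auto intro!: subspace_scale subspace_orthogonal_comp)
qed

lemma unit_vectors_eqI:
  assumes "norm x = 1" "norm y = 1" "1 \<le> x \<bullet> y"
  shows "x = (y :: 'a::real_inner)"
proof -
  have "(norm (x - y))\<^sup>2 = (norm x)\<^sup>2 + (norm y)\<^sup>2 - 2 * (x \<bullet> y)"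
    unfolding power2_norm_eq_inner by (simp add: inner_simps inner_commute)
  also have "\<dots> \<le> 0" using assms by simp
  finally show ?thesis by simp
qed

text \<open>
  The maximum is attained by compactness. It is nonnegative since one of the vectors may be replaced
  by its negative, and less than 1 since otherwise the two vectors would coincide and lie both in the
  intersection and in its complement.
\<close>

lemma friedrichs_cosines_greatest:
  assumes "subspace U" "subspace V" and nonempty: "friedrichs_cosines U V \<noteq> {}"
  obtains c where "c \<in> friedrichs_cosines U V" "\<And>d. d \<in> friedrichs_cosines U V \<Longrightarrow> d \<le> c"
    "0 \<le> c" "c < 1"
proof -
  let ?W = "(U \<inter> V)\<^sup>\<bottom>"
  define K where "K = (U \<inter> ?W \<inter> sphere 0 1) \<times> (V \<inter> ?W \<inter> sphere 0 1)"
  have cos_eq: "friedrichs_cosines U V = (\<lambda>z. fst z \<bullet> snd z) ` K"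
    unfolding friedrichs_cosines_def K_def by force
  have "compact K"
    unfolding K_def using assms
    by (intro compact_Times closed_Int_compact closed_Int closed_subspace subspace_orthogonal_comp
        compact_sphere)
  moreover have "K \<noteq> {}" using nonempty cos_eq by blast
  moreover have "continuous_on K (\<lambda>z. fst z \<bullet> snd z)"
    by (intro continuous_intros)
  ultimately obtain z where z: "z \<in> K" "\<And>z'. z' \<in> K \<Longrightarrow> fst z' \<bullet> snd z' \<le> fst z \<bullet> snd z"
    using continuous_attains_sup[of K "\<lambda>z. fst z \<bullet> snd z"] by blast
  obtain x y where xy: "z = (x, y)" by fastforce
  have x: "x \<in> U" "x \<in> ?W" "norm x = 1" and y: "y \<in> V" "y \<in> ?W" "norm y = 1"
    using z(1) unfolding K_def xy by auto
  have "(- x, y) \<in> K"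
    unfolding K_def using x y assms(1)
    by (auto intro: subspace_neg subspace_neg[OF subspace_orthogonal_comp])
  from z(2)[OF this] have "- (x \<bullet> y) \<le> x \<bullet> y"
    by (simp only: xy fst_conv snd_conv inner_minus_left)
  then have "0 \<le> x \<bullet> y" by linarith
  moreover have "x \<bullet> y < 1"
  proof (rule ccontr)
    assume "\<not> x \<bullet> y < 1"
    then have "x = y" using x(3) y(3) by (intro unit_vectors_eqI[of x y]) simp_all
    then have "x \<in> U \<inter> V" using x(1) y(1) by simp
    then have "x = 0" using x(2) by (rule orthogonal_comp_Int_self)
    with x(3) show False by simp
  qed
  moreover have "x \<bullet> y \<in> friedrichs_cosines U V"
    unfolding cos_eq by (rule image_eqI[OF _ z(1)]) (simp add: xy)
  moreover have "d \<le> x \<bullet> y" if "d \<in> friedrichs_cosines U V" for d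
  proof -
    from that obtain z' where "z' \<in> K" "d = fst z' \<bullet> snd z'"
      unfolding cos_eq by (rule imageE)
    with z(2)[of z'] show ?thesis by (simp add: xy)
  qed
  ultimately show thesis by (intro that)
qed

lemma arccos_acute:
  assumes "0 \<le> c" "c < 1"
  shows "0 < arccos c" "arccos c \<le> pi / 2" "cos (arccos c) = c"
proof -
  show c: "cos (arccos c) = c" using assms by (intro cos_arccos) auto
  show "arccos c \<le> pi / 2" using assms by (intro arccos_le_pi2) auto
  have "arccos c \<noteq> 0"
  proof
    assume "arccos c = 0"
    with c have "c = 1" by simp
    with assms show False by simp
  qed
  moreover have "0 \<le> arccos c" using assms by (intro arccos_lbound) auto
  ultimately show "0 < arccos c" by simp
qed

lemma friedrichs_angle_eq:
  assumes c: "c \<in> friedrichs_cosines U V" "\<And>d. d \<in> friedrichs_cosines U V \<Longrightarrow> d \<le> c"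
    and c01: "0 \<le> c" "c < 1"
  shows "friedrichs_angle U V = arccos c"
proof -
  have "(GREATEST c. c \<in> friedrichs_cosines U V) = c"
    using c by (intro Greatest_equality)
  moreover have "(THE \<theta>. 0 < \<theta> \<and> \<theta> \<le> pi/2 \<and> cos \<theta> = c) = arccos c"
  proof (rule the_equality)
    fix \<theta> assume \<theta>: "0 < \<theta> \<and> \<theta> \<le> pi/2 \<and> cos \<theta> = c"
    then have "arccos (cos \<theta>) = \<theta>" by (intro arccos_cos) auto
    with \<theta> show "\<theta> = arccos c" by simp
  qed (use arccos_acute[OF c01] in auto)
  ultimately show ?thesis
    using c(1) unfolding friedrichs_angle_def by auto
qed

text \<open>
  These properties hold also in the degenerate case without admissible pairs, where the
  angle is a right angle and its cosine 0.
\<close>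

lemma cos_friedrichs_angle:
  assumes "subspace U" "subspace V"
  shows "0 \<le> cos (friedrichs_angle U V)"
    and "d \<in> friedrichs_cosines U V \<Longrightarrow> d \<le> cos (friedrichs_angle U V)"
    and "cos (friedrichs_angle U V) \<noteq> 0 \<Longrightarrow> cos (friedrichs_angle U V) \<in> friedrichs_cosines U V"
proof -
  let ?c = "cos (friedrichs_angle U V)"
  have "0 \<le> ?c \<and> (\<forall>d\<in>friedrichs_cosines U V. d \<le> ?c) \<and> (?c \<noteq> 0 \<longrightarrow> ?c \<in> friedrichs_cosines U V)"
  proof (cases "friedrichs_cosines U V = {}")
    case True
    then show ?thesis by (simp add: friedrichs_angle_def)
  next
    case False
    then obtain c where c: "c \<in> friedrichs_cosines U V" "\<And>d. d \<in> friedrichs_cosines U V \<Longrightarrow> d \<le> c"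
        "0 \<le> c" "c < 1"
      using friedrichs_cosines_greatest[OF assms] by blast
    then have "?c = c" by (simp only: friedrichs_angle_eq arccos_acute)
    with c show ?thesis by simp
  qed
  then show "0 \<le> ?c" and "d \<in> friedrichs_cosines U V \<Longrightarrow> d \<le> ?c"
    and "?c \<noteq> 0 \<Longrightarrow> ?c \<in> friedrichs_cosines U V"
    by blast+
qed

text \<open>
  As long as fewer than dim (U \<inter> V) pairs have been chosen, all of them with equal entries, there
  is a unit vector e in the intersection orthogonal to them. The pair (e, e) is admissible with cosine 1, so
  the maximizing pair also has cosine 1 and consists of equal vectors.
\<close>

lemma principal_vectors_common:
  assumes pv: "principal_vectors U V k u v" and k: "j \<le> k"
    and U: "subspace U" and V: "subspace V" and j: "1 \<le> j" "j \<le> dim (U \<inter> V)"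
  shows "u j = v j \<and> u j \<in> U \<inter> V"
  using k j
proof (induction j rule: less_induct)
  case (less j)
  let ?S = "u ` {1..<j}"
  have adm: "principal_admissible U V u v j (u j) (v j)"
    and max: "\<And>x y. principal_admissible U V u v j x y \<Longrightarrow> x \<bullet> y \<le> u j \<bullet> v j"
    using pv less.prems unfolding principal_vectors_def by auto
  have IH: "u i = v i \<and> u i \<in> U \<inter> V" if "i \<in> {1..<j}" for i
    using less.IH[of i] less.prems that by auto
  have W: "span (U \<inter> V) = U \<inter> V"
    using U V by (simp add: span_eq_iff subspace_inter)
  have "span ?S \<subseteq> span (U \<inter> V)"
    using IH by (intro span_mono) blast
  moreover have "dim (span ?S) < dim (span (U \<inter> V))"
  proof -
    have "dim ?S \<le> card ?S" by (intro dim_le_card') simp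
    also have "\<dots> \<le> card {1..<j}" by (intro card_image_le) simp
    finally show ?thesis using less.prems by (simp add: W)
  qed
  moreover from this have "span ?S \<noteq> span (U \<inter> V)" by (metis less_irrefl)
  ultimately have "span ?S \<subset> span (U \<inter> V)" by blast
  then obtain w where w: "w \<noteq> 0" "w \<in> U \<inter> V" and orth: "\<And>y. y \<in> span ?S \<Longrightarrow> orthogonal w y"
    using orthogonal_to_subspace_exists_gen[of ?S "U \<inter> V"] W by metis
  define e where "e = inverse (norm w) *\<^sub>R w"
  have e: "e \<in> U" "e \<in> V" "norm e = 1"
    using w U V by (auto simp: e_def intro: subspace_scale)
  have "e \<bullet> u i = 0" if "i \<in> {1..<j}" for i
    using orth[of "u i"] that by (simp add: e_def orthogonal_def span_base)
  then have "principal_admissible U V u v j e e"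
    using e IH unfolding principal_admissible_def by auto
  from max[OF this] have "1 \<le> u j \<bullet> v j" using e by (simp add: dot_square_norm)
  then have "u j = v j"
    using adm unfolding principal_admissible_def by (intro unit_vectors_eqI[of "u j" "v j"]) auto
  with adm show ?case unfolding principal_admissible_def by auto
qed

text \<open>
  The first dim (U \<inter> V) vectors are an orthonormal family in the intersection of full length, hence
  span it, and orthogonality to all of them is orthogonality to the intersection.
\<close>

lemma principal_admissible_past_intersection:
  assumes pv: "principal_vectors U V k u v" and k: "dim (U \<inter> V) \<le> k"
    and U: "subspace U" and V: "subspace V"
  shows "principal_admissible U V u v (dim (U \<inter> V) + 1) x y \<longleftrightarrow>
    x \<in> U \<inter> (U \<inter> V)\<^sup>\<bottom> \<and> y \<in> V \<inter> (U \<inter> V)\<^sup>\<bottom> \<and> norm x = 1 \<and> norm y = 1"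
proof -
  let ?W = "U \<inter> V" and ?s = "dim (U \<inter> V)"
  let ?B = "u ` {1..?s}"
  have common: "u j = v j \<and> u j \<in> ?W" if "j \<in> {1..?s}" for j
    by (rule principal_vectors_common[OF pv _ U V]) (use that k in auto)
  have adm: "principal_admissible U V u v j (u j) (v j)" if "j \<in> {1..?s}" for j
    using pv that k unfolding principal_vectors_def by auto
  have unit: "norm (u j) = 1" if "j \<in> {1..?s}" for j
    using adm[OF that] unfolding principal_admissible_def by blast
  have orth: "u i \<bullet> u j = 0" if "i \<in> {1..?s}" "j \<in> {1..?s}" "i \<noteq> j" for i j
  proof (cases "i < j")
    case True
    then show ?thesis
      using adm[OF that(2)] that unfolding principal_admissible_def by (auto simp: inner_commute)
  next
    case False
    then show ?thesis
      using adm[OF that(1)] that unfolding principal_admissible_def by auto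
  qed
  have "inj_on u {1..?s}"
  proof (rule inj_onI, rule ccontr)
    fix i j assume ij: "i \<in> {1..?s}" "j \<in> {1..?s}" "u i = u j" "i \<noteq> j"
    then have "u i \<bullet> u i = 0" using orth[of i j] by simp
    then show False using unit[OF ij(1)] by simp
  qed
  then have "card ?B = ?s" by (simp add: card_image)
  moreover have "independent ?B"
  proof (rule pairwise_orthogonal_independent)
    show "pairwise orthogonal ?B"
      by (auto simp: pairwise_def orthogonal_def intro!: orth)
    show "0 \<notin> ?B" using unit by force
  qed
  moreover have B: "?B \<subseteq> ?W" using common by blast
  ultimately have "?W \<subseteq> span ?B"
    by (intro card_ge_dim_independent) auto
  then have comp: "z \<in> ?W\<^sup>\<bottom> \<longleftrightarrow> (\<forall>j\<in>{1..?s}. z \<bullet> u j = 0)" for z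
  proof (intro iffI ballI)
    assume *: "\<forall>j\<in>{1..?s}. z \<bullet> u j = 0" 
    have "orthogonal z w" if "w \<in> span ?B" for w
      using that by (rule orthogonal_to_span) (use * in \<open>auto simp: orthogonal_def\<close>)
    with \<open>?W \<subseteq> span ?B\<close> show "z \<in> ?W\<^sup>\<bottom>"
      by (intro orthogonal_compI) (auto simp: orthogonal_def)
  next
    fix j assume "z \<in> ?W\<^sup>\<bottom>" "j \<in> {1..?s}"
    then show "z \<bullet> u j = 0" using B by (intro orthogonal_compD(1)[of z ?W]) auto
  qed
  have "{1..<?s + 1} = {1..?s}" by auto
  then show ?thesis
    using common unfolding principal_admissible_def Int_iff comp by auto
qed

text \<open>
  The preceding lemma reduces the maximum at this step to the Friedrichs cosine, for every choice of
  principal vectors. One choice consists of an orthonormal basis of the intersection, used for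
  both families, followed by a maximizing pair of the Friedrichs angle.
\<close>

lemma principal_angle_past_intersection:
  assumes U: "subspace U" and V: "subspace V" and le: "dim (U \<inter> V) + 1 \<le> min (dim U) (dim V)"
    and c: "c \<in> friedrichs_cosines U V" "\<And>d. d \<in> friedrichs_cosines U V \<Longrightarrow> d \<le> c"
    and c01: "0 \<le> c" "c < 1"
  shows "principal_angle U V (dim (U \<inter> V) + 1) = arccos c"
proof -
  let ?W = "U \<inter> V" and ?s = "dim (U \<inter> V)"
  have val: "u (?s + 1) \<bullet> v (?s + 1) = c" if pv: "principal_vectors U V (?s + 1) u v" for u v
  proof -
    have adm: "principal_admissible U V u v (?s + 1) x y \<longleftrightarrow>
        x \<in> U \<inter> ?W\<^sup>\<bottom> \<and> y \<in> V \<inter> ?W\<^sup>\<bottom> \<and> norm x = 1 \<and> norm y = 1" for x y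
      by (rule principal_admissible_past_intersection[OF pv _ U V]) simp
    have last: "principal_admissible U V u v (?s + 1) (u (?s + 1)) (v (?s + 1))"
      and max: "\<And>x y. principal_admissible U V u v (?s + 1) x y \<Longrightarrow> x \<bullet> y \<le> u (?s + 1) \<bullet> v (?s + 1)"
      using pv unfolding principal_vectors_def by auto
    have "u (?s + 1) \<bullet> v (?s + 1) \<in> friedrichs_cosines U V"
      using last unfolding adm friedrichs_cosines_def by blast
    moreover obtain x y where "c = x \<bullet> y" "principal_admissible U V u v (?s + 1) x y"
      using c(1) unfolding adm friedrichs_cosines_def by blast
    ultimately show ?thesis using max[of x y] c(2) by (intro antisym) auto
  qed
  have exists: "\<exists>u v. principal_vectors U V (?s + 1) u v"
  proof -
    obtain B where B: "B \<subseteq> ?W" "pairwise orthogonal B" "\<And>b. b \<in> B \<Longrightarrow> norm b = 1"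
        "independent B" "card B = ?s" "span B = ?W"
      using orthonormal_basis_subspace[OF subspace_inter[OF U V]] by metis
    then obtain f where f: "bij_betw f {1..?s} B"
      using ex_bij_betw_nat_finite_1[of B] independent_imp_finite by metis
    obtain x y where xy: "x \<in> U \<inter> ?W\<^sup>\<bottom>" "y \<in> V \<inter> ?W\<^sup>\<bottom>" "norm x = 1" "norm y = 1" "x \<bullet> y = c"
      using c(1) unfolding friedrichs_cosines_def by blast
    define u v where "u j = (if j \<le> ?s then f j else x)" and "v j = (if j \<le> ?s then f j else y)" for j
    have fB: "f j \<in> B" "f j \<in> ?W" "norm (f j) = 1" if "j \<in> {1..?s}" for j
      using bij_betwE[OF f] that B by blast+
    have f_orth: "f j \<bullet> f i = 0" if "i \<in> {1..?s}" "j \<in> {1..?s}" "i \<noteq> j" for i j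
    proof -
      have "f i \<noteq> f j"
        using bij_betw_imp_inj_on[OF f] that by (auto dest: inj_onD)
      then show ?thesis
        using pairwiseD[OF B(2) fB(1)[OF that(2)] fB(1)[OF that(1)]] by (auto simp: orthogonal_def)
    qed
    have first: "principal_admissible U V u v j (u j) (v j)" if "j \<in> {1..?s}" for j
      using that fB[OF that] f_orth unfolding principal_admissible_def by (auto simp: u_def v_def)
    have first_max: "a \<bullet> b \<le> u j \<bullet> v j"
      if "j \<in> {1..?s}" "principal_admissible U V u v j a b" for j a b
    proof -
      have "a \<bullet> b \<le> norm a * norm b" by (rule norm_cauchy_schwarz)
      also have "\<dots> = u j \<bullet> v j"
        using that fB(3)[OF that(1)] unfolding principal_admissible_def
        by (simp add: u_def v_def dot_square_norm)
      finally show ?thesis .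
    qed
    have "principal_vectors U V ?s u v"
      using first first_max unfolding principal_vectors_def by blast
    then have adm: "principal_admissible U V u v (?s + 1) a b \<longleftrightarrow>
        a \<in> U \<inter> ?W\<^sup>\<bottom> \<and> b \<in> V \<inter> ?W\<^sup>\<bottom> \<and> norm a = 1 \<and> norm b = 1" for a b
      by (rule principal_admissible_past_intersection[OF _ order_refl U V])
    have uv: "u (?s + 1) = x" "v (?s + 1) = y" by (simp_all add: u_def v_def)
    have "principal_vectors U V (?s + 1) u v"
      unfolding principal_vectors_def
    proof (intro ballI)
      fix j assume "j \<in> {1..?s + 1}"
      then consider "j \<in> {1..?s}" | "j = ?s + 1" by fastforce
      then show "principal_admissible U V u v j (u j) (v j) \<and>
          (\<forall>a b. principal_admissible U V u v j a b \<longrightarrow> a \<bullet> b \<le> u j \<bullet> v j)"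
      proof cases
        case 1
        then show ?thesis using first first_max by blast
      next
        case 2
        have "a \<bullet> b \<le> c" if "principal_admissible U V u v (?s + 1) a b" for a b
          using that unfolding adm by (intro c(2)) (auto simp: friedrichs_cosines_def)
        then show ?thesis unfolding 2 uv adm using xy by (auto simp: adm)
      qed
    qed
    then show ?thesis by blast
  qed
  have "(THE \<theta>. 0 \<le> \<theta> \<and> \<theta> \<le> pi/2 \<and> (\<exists>u v. principal_vectors U V (?s + 1) u v \<and>
      cos \<theta> = u (?s + 1) \<bullet> v (?s + 1))) = arccos c"
  proof (rule the_equality)
    fix \<theta> assume "0 \<le> \<theta> \<and> \<theta> \<le> pi/2 \<and> (\<exists>u v. principal_vectors U V (?s + 1) u v \<and>
      cos \<theta> = u (?s + 1) \<bullet> v (?s + 1))"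
    then have \<theta>: "0 \<le> \<theta>" "\<theta> \<le> pi/2" "cos \<theta> = c" using val by auto
    then have "arccos (cos \<theta>) = \<theta>" by (intro arccos_cos) auto
    with \<theta> show "\<theta> = arccos c" by simp
  next
    obtain u v where "principal_vectors U V (?s + 1) u v" using exists by blast
    moreover from val[OF this] have "cos (arccos c) = u (?s + 1) \<bullet> v (?s + 1)"
      using arccos_acute[OF c01] by simp
    ultimately show "0 \<le> arccos c \<and> arccos c \<le> pi/2 \<and> (\<exists>u v. principal_vectors U V (?s + 1) u v \<and>
      cos (arccos c) = u (?s + 1) \<bullet> v (?s + 1))"
      using arccos_acute[OF c01] less_imp_le by blast
  qed
  then show ?thesis unfolding principal_angle_def if_P[OF le] .
qed

text \<open>
  If U is contained in V, both sides are a right angle by convention: there is no admissible pair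
  on either side. Otherwise, as V is at least as large as U, both subspaces properly contain the
  intersection.
\<close>

lemma principal_angle_eq_friedrichs_angle:
  assumes U: "subspace U" and V: "subspace V" and le: "dim U \<le> dim V"
  shows "principal_angle U V (dim (U \<inter> V) + 1) = friedrichs_angle U V"
proof (cases "U \<subseteq> V")
  case True
  then have UV: "U \<inter> V = U" by blast
  have "friedrichs_cosines U V = {}"
  proof (rule ccontr)
    assume "friedrichs_cosines U V \<noteq> {}"
    then obtain x where "x \<in> U" "x \<in> U\<^sup>\<bottom>" "norm x = 1"
      unfolding friedrichs_cosines_def UV by blast
    then show False using orthogonal_comp_Int_self[of x U] by simp
  qed
  with le show ?thesis unfolding principal_angle_def friedrichs_angle_def UV by simp
next
  case False
  let ?W = "U \<inter> V"
  have W: "subspace ?W" using U V by (rule subspace_inter)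
  have "?W \<noteq> U" using False by blast
  then have "dim ?W < dim U"
    using subspace_dim_equal[OF W U] by (meson Int_lower1 not_le)
  with le have dims: "dim ?W + 1 \<le> min (dim U) (dim V)" by simp
  have "?W \<noteq> V" using dims by auto
  obtain x where "x \<in> U" "x \<in> ?W\<^sup>\<bottom>" "norm x = 1"
    using unit_vector_in_relative_complement[OF W U _ \<open>?W \<noteq> U\<close>] by blast
  moreover obtain y where "y \<in> V" "y \<in> ?W\<^sup>\<bottom>" "norm y = 1"
    using unit_vector_in_relative_complement[OF W V _ \<open>?W \<noteq> V\<close>] by blast
  ultimately have "friedrichs_cosines U V \<noteq> {}"
    unfolding friedrichs_cosines_def by blast
  then obtain c where c: "c \<in> friedrichs_cosines U V" "\<And>d. d \<in> friedrichs_cosines U V \<Longrightarrow> d \<le> c"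
        "0 \<le> c" "c < 1"
    using friedrichs_cosines_greatest[OF U V] by blast
  show ?thesis
    using principal_angle_past_intersection[OF U V dims c] friedrichs_angle_eq[OF c] by simp
qed

section \<open>Normality and convergence of the relaxed operator\<close>

text \<open>
  R and its transpose, in which P and Q are exchanged, commute: both products are Id - D^2.
  Hence so do their combinations with Id.
\<close>

lemma normal_relaxed_dr_mat:
  assumes U: "subspace U" and V: "subspace V"
  shows "normal_mat (relaxed_dr_mat U V \<mu>)"
proof -
  let ?P = "proj_mat U" and ?Q = "proj_mat V"
  interpret two_projections "(*v) ?P" "(*v) ?Q"
    by (rule two_projections_proj_mat[OF U V])
  have R: "dr_mat U V = mat 1 - ?P - ?Q + 2 *\<^sub>R (?P ** ?Q)"
    unfolding matrix_eq
    by (simp add: dr_mat_vector_mult[OF U V] matrix_vector_mult_add_rdistrib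
        matrix_vector_mult_diff_rdistrib flip: scaleR_matrix_vector_assoc matrix_vector_mul_assoc)
  have "transpose (dr_mat U V) = mat 1 - ?P - ?Q + 2 *\<^sub>R transpose (?P ** ?Q)"
    using transpose_proj_mat[OF U] transpose_proj_mat[OF V]
    unfolding R by (simp add: transpose_def vec_eq_iff mat_def)
  then have RT: "transpose (dr_mat U V) = mat 1 - ?P - ?Q + 2 *\<^sub>R (?Q ** ?P)"
    by (simp add: matrix_transpose_mul transpose_proj_mat[OF U] transpose_proj_mat[OF V])
  have RT_mult: "transpose (dr_mat U V) *v x = x - ?P *v x - ?Q *v x + 2 *\<^sub>R (?Q *v (?P *v x))" for x
    unfolding RT
    by (simp add: matrix_vector_mult_add_rdistrib
        matrix_vector_mult_diff_rdistrib flip: scaleR_matrix_vector_assoc matrix_vector_mul_assoc)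
  have T: "transpose (relaxed_dr_mat U V \<mu>) = (1 - \<mu>) *\<^sub>R mat 1 + \<mu> *\<^sub>R transpose (dr_mat U V)"
    unfolding relaxed_dr_mat_def by (simp add: transpose_def vec_eq_iff mat_def)
  have T_mult: "transpose (relaxed_dr_mat U V \<mu>) *v x
      = (1 - \<mu>) *\<^sub>R x + \<mu> *\<^sub>R (transpose (dr_mat U V) *v x)" for x
    unfolding T by (simp add: matrix_vector_mult_add_rdistrib flip: scaleR_matrix_vector_assoc)
  have "dr_mat U V *v (transpose (dr_mat U V) *v x) = transpose (dr_mat U V) *v (dr_mat U V *v x)" for x
    unfolding RT_mult dr_mat_vector_mult[OF U V]
    by (simp add: linear_simps algebra_simps)
  then show ?thesis
    unfolding normal_mat_def matrix_eq matrix_vector_mul_assoc[symmetric]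
      T_mult relaxed_dr_mat_vector_mult
    by (simp add: matrix_vector_right_distrib matrix_vector_mult_scaleR algebra_simps)
qed

theorem theorem3p10:
  fixes U V :: "(real^'n) set" and \<mu> :: real and p q s :: nat
  assumes "subspace U" and "subspace V"
    and "p = dim U" and "q = dim V" and "s = dim (U \<inter> V)"
    and "1 \<le> p" and "p \<le> q" and "q \<le> CARD('n) - 1"
  shows "(U \<noteq> V \<longrightarrow> (mat_convergent (relaxed_dr_mat U V \<mu>) \<longleftrightarrow> \<mu> \<in> {0..<2}))
    \<and> normal_mat (relaxed_dr_mat U V \<mu>)
    \<and> (\<mu> \<in> {0<..<2} \<longrightarrow>
         mat_convergent_to (relaxed_dr_mat U V \<mu>) (proj_mat (fix_space (dr_mat U V)))
       \<and> (U \<inter> V) \<inter> (U\<^sup>\<bottom> \<inter> V\<^sup>\<bottom>) = {0}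
       \<and> proj_mat (fix_space (dr_mat U V)) = proj_mat ((U \<inter> V) + (U\<^sup>\<bottom> \<inter> V\<^sup>\<bottom>))
       \<and> is_optimal_conv_rate (relaxed_dr_mat U V \<mu>) (proj_mat (fix_space (dr_mat U V)))
           (gamma_mat (relaxed_dr_mat U V \<mu>))
       \<and> (U \<noteq> V \<longrightarrow> gamma_mat (relaxed_dr_mat U V \<mu>) =
            sqrt (\<mu> * (2 - \<mu>) * (cos (principal_angle U V (s + 1)))\<^sup>2 + (1 - \<mu>)\<^sup>2)))
    \<and> principal_angle U V (s + 1) = friedrichs_angle U V"
proof -
  note U = \<open>subspace U\<close> and V = \<open>subspace V\<close>
  let ?P = "proj_mat U" and ?Q = "proj_mat V"
  let ?A = "relaxed_dr_mat U V \<mu>"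
  interpret two_projections "(*v) ?P" "(*v) ?Q"
    by (rule two_projections_proj_mat[OF U V])
  have R_eq: "dr_mat U V *v x = R x" for x
    unfolding R_def by (rule dr_mat_vector_mult[OF U V])
  have A_eq: "?A *v x = T \<mu> x" for x
    unfolding T_def R_eq[symmetric] by (rule relaxed_dr_mat_vector_mult)
  have pow_eq: "matpow ?A k *v x = (T \<mu> ^^ k) x" for k x
  proof -
    have "(*v) ?A = T \<mu>" using A_eq by (rule ext)
    then show ?thesis by (simp only: matpow_vector_mult)
  qed
  have fix_E: "fix_space (dr_mat U V) = E"
    using R_fixed_iff by (auto simp: fix_space_def matrix_vector_mult_diff_rdistrib R_eq)
  have U_iff: "?P *v x = x \<longleftrightarrow> x \<in> U" and V_iff: "?Q *v x = x \<longleftrightarrow> x \<in> V" for x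
    using proj_mat_fixed_iff[OF U] proj_mat_fixed_iff[OF V] by blast+
  have U_zero: "?P *v x = 0 \<longleftrightarrow> x \<in> U\<^sup>\<bottom>" and V_zero: "?Q *v x = 0 \<longleftrightarrow> x \<in> V\<^sup>\<bottom>" for x
    using proj_mat_zero_iff[OF U] proj_mat_zero_iff[OF V] by blast+
  have E_sum: "E = (U \<inter> V) + (U\<^sup>\<bottom> \<inter> V\<^sup>\<bottom>)"
  proof (intro equalityI subsetI)
    fix x assume "x \<in> E"
    then have PQ: "?P *v x = ?Q *v x" by (simp add: E_def D_def)
    have "?P *v x \<in> U \<inter> V" "x - ?P *v x \<in> U\<^sup>\<bottom> \<inter> V\<^sup>\<bottom>"
      using proj_mat_works[OF U, of x] proj_mat_works[OF V, of x] unfolding PQ by blast+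
    then have "?P *v x + (x - ?P *v x) \<in> (U \<inter> V) + (U\<^sup>\<bottom> \<inter> V\<^sup>\<bottom>)"
      by (rule set_plus_intro)
    then show "x \<in> (U \<inter> V) + (U\<^sup>\<bottom> \<inter> V\<^sup>\<bottom>)" by simp
  next
    fix x assume "x \<in> (U \<inter> V) + (U\<^sup>\<bottom> \<inter> V\<^sup>\<bottom>)"
    then obtain a b where ab: "x = a + b" "a \<in> U \<inter> V" "b \<in> U\<^sup>\<bottom> \<inter> V\<^sup>\<bottom>"
      by (rule set_plus_elim)
    then have "?P *v a = a" "?Q *v a = a" "?P *v b = 0" "?Q *v b = 0"
      using U_iff V_iff U_zero V_zero by blast+
    then show "x \<in> E" unfolding ab(1) by (simp add: E_def D_def linear_simps)
  qed
  \<comment> \<open>Within U, the complements of E and of the intersection of U and V agree, because the second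
      summand of E is orthogonal to U. This links the pairs in the complement of E to those of the
      Friedrichs angle.\<close>
  have U_comp: "x \<in> E\<^sup>\<bottom>" if "x \<in> U" "x \<in> (U \<inter> V)\<^sup>\<bottom>" for x
  proof (rule orthogonal_compI)
    fix f assume f: "f \<in> E"
    then have "?P *v f = ?Q *v f" by (simp add: E_def D_def)
    then have "?P *v f \<in> U \<inter> V"
      using proj_mat_works(1)[OF U, of f] proj_mat_works(1)[OF V, of f] by simp
    then have "x \<bullet> (?P *v f) = 0" using that(2) by (rule orthogonal_compD(1)[rotated])
    moreover have "?P *v x = x" using that(1) U_iff by blast
    ultimately show "x \<bullet> f = 0" using P_sym[of x f] by simp
  qed
  have comp_le: "x \<in> (U \<inter> V)\<^sup>\<bottom>" if "x \<in> E\<^sup>\<bottom>" for x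
  proof -
    have "z \<in> E" if "z \<in> U \<inter> V" for z
      using that U_iff[of z] V_iff[of z] by (simp add: E_def D_def)
    then show ?thesis using that orthogonal_comp_anti_mono[of "U \<inter> V" E] by blast
  qed
  define c where "c = cos (friedrichs_angle U V)"
  have angle: "principal_angle U V (s + 1) = friedrichs_angle U V"
    using principal_angle_eq_friedrichs_angle[OF U V] assms by simp
  define g where "g = sqrt (\<mu> * (2 - \<mu>) * c\<^sup>2 + (1 - \<mu>)\<^sup>2)"
  have c0: "0 \<le> c" unfolding c_def by (rule cos_friedrichs_angle[OF U V])
  have gap: "\<exists>x. x \<in> E\<^sup>\<bottom> \<and> norm x = 1 \<and> D (D x) = (1 - c\<^sup>2) *\<^sub>R x \<and>
      (\<forall>y\<in>E\<^sup>\<bottom>. (1 - c\<^sup>2) * (norm y)\<^sup>2 \<le> (norm (D y))\<^sup>2) \<and> c < 1" if "E\<^sup>\<bottom> \<noteq> {0}"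
  proof -
    have bound: "x \<bullet> y \<le> c * norm x * norm y"
      if xy: "?P *v x = x" "?Q *v y = y" "x \<in> E\<^sup>\<bottom>" "y \<in> E\<^sup>\<bottom>" for x y
    proof (cases "x = 0 \<or> y = 0")
      case False
      define x' y' where "x' = inverse (norm x) *\<^sub>R x" and "y' = inverse (norm y) *\<^sub>R y"
      have "x' \<in> U \<inter> (U \<inter> V)\<^sup>\<bottom>" "y' \<in> V \<inter> (U \<inter> V)\<^sup>\<bottom>"
        unfolding x'_def y'_def Int_iff using xy U V comp_le U_iff V_iff
        by (auto intro!: subspace_scale[OF subspace_orthogonal_comp] intro: subspace_scale)
      moreover have "norm x' = 1" "norm y' = 1" using False by (simp_all add: x'_def y'_def)
      ultimately have "x' \<bullet> y' \<in> friedrichs_cosines U V"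
        unfolding friedrichs_cosines_def by blast
      then have "x' \<bullet> y' \<le> c" unfolding c_def by (rule cos_friedrichs_angle[OF U V])
      then show ?thesis using False by (simp add: x'_def y'_def field_simps)
    qed auto
    have attained: "\<exists>x y. ?P *v x = x \<and> ?Q *v y = y \<and> x \<in> E\<^sup>\<bottom> \<and> norm x = 1 \<and> norm y = 1 \<and> x \<bullet> y = c"
      if "c \<noteq> 0"
    proof -
      have "c \<in> friedrichs_cosines U V"
        using cos_friedrichs_angle(3)[OF U V] that unfolding c_def by blast
      then obtain x y where "x \<in> U \<inter> (U \<inter> V)\<^sup>\<bottom>" "y \<in> V" "norm x = 1" "norm y = 1" "c = x \<bullet> y"
        unfolding friedrichs_cosines_def by blast
      then show ?thesis using U_comp U_iff V_iff by (intro exI[of _ x] exI[of _ y]) simp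
    qed
    show ?thesis
      by (rule minimal_gap[OF c0 bound attained that]) blast+
  qed
  have E_proper: "E\<^sup>\<bottom> \<noteq> {0}" if "U \<noteq> V"
  proof
    assume "E\<^sup>\<bottom> = {0}"
    then have "E = UNIV" using orthogonal_comp_self[OF subspace_E] by simp
    then have "?P *v x = ?Q *v x" for x by (auto simp: E_def D_def)
    then have "U = V" using U_iff V_iff by (metis subsetI subset_antisym)
    with that show False by simp
  qed
  \<comment> \<open>For U = V the operator is the identity and its complementary part is trivial; then the factor is 0.\<close>
  have rate: "gamma_mat ?A = h \<and> is_optimal_conv_rate ?A (proj_mat E) h"
    if \<mu>: "\<mu> \<in> {0<..<2}" and h: "h = (if U = V then 0 else g)" for h
  proof -
    have fixes_E: "?A *v x = x" if "x \<in> E" for x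
      using T_fixes_E[OF that] by (simp add: A_eq)
    have invariant: "?A *v x \<in> E\<^sup>\<bottom>" if "x \<in> E\<^sup>\<bottom>" for x
      using T_mem_E_comp[OF that] by (simp add: A_eq)
    have "0 \<le> h \<and> h < 1 \<and> (\<forall>x\<in>E\<^sup>\<bottom>. norm (?A *v x) \<le> h * norm x) \<and>
        (h \<noteq> 0 \<longrightarrow> (\<exists>x\<in>E\<^sup>\<bottom>. x \<noteq> 0 \<and> (\<forall>k. norm (matpow ?A k *v x) = h ^ k * norm x)) \<and>
          (\<exists>z\<in>eigvals ?A. cmod z = h))"
    proof (cases "U = V")
      case True
      then have "D x = 0" for x unfolding D_def by simp
      then have "E = UNIV" unfolding E_def by simp
      moreover have "h = 0" using True h by simp
      ultimately show ?thesis by simp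
    next
      case False
      then have hg: "h = g" using h by simp
      obtain x where x: "x \<in> E\<^sup>\<bottom>" "norm x = 1" "D (D x) = (1 - c\<^sup>2) *\<^sub>R x" and c1: "c < 1"
        and min: "\<And>y. y \<in> E\<^sup>\<bottom> \<Longrightarrow> (1 - c\<^sup>2) * (norm y)\<^sup>2 \<le> (norm (D y))\<^sup>2"
        using gap[OF E_proper[OF False]] by blast
      have "x \<noteq> 0" using x(2) by auto
      have c21: "c\<^sup>2 < 1" using c0 c1 by (simp add: power_less_one_iff)
      have "\<mu> * (2 - \<mu>) > 0" using \<mu> by simp
      then have "\<mu> * (2 - \<mu>) * c\<^sup>2 < \<mu> * (2 - \<mu>) * 1"
        using c21 by (intro mult_strict_left_mono)
      also have "\<mu> * (2 - \<mu>) * 1 = 1 - (1 - \<mu>)\<^sup>2" by algebra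
      finally have g1: "g < 1" unfolding g_def by (simp add: real_sqrt_less_iff)
      have g0: "0 \<le> g" using \<mu> by (simp add: g_def)
      have g2: "g\<^sup>2 = \<mu> * (2 - \<mu>) * c\<^sup>2 + (1 - \<mu>)\<^sup>2" using \<mu> by (simp add: g_def)
      have contraction: "norm (?A *v y) \<le> g * norm y" if "y \<in> E\<^sup>\<bottom>" for y
        unfolding A_eq g_def using norm_T_le[OF min[OF that]] \<mu> by simp
      have sharp: "norm (matpow ?A k *v x) = g ^ k * norm x" for k
        unfolding pow_eq using norm_T_iterate[OF x(3) g_def] \<mu> by simp
      \<comment> \<open>The real and imaginary part of 1 - \<mu> + \<mu> t, where t = c^2 + i c sqrt (1 - c^2) is a root
          of t^2 = 2 c^2 t - c^2, the equation of R on the eigenspace of x.\<close>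
      define a b where "a = 1 - \<mu> + \<mu> * c\<^sup>2" and "b = \<mu> * c * sqrt (1 - c\<^sup>2)"
      have "b\<^sup>2 = \<mu>\<^sup>2 * c\<^sup>2 * (1 - c\<^sup>2)"
        using c21 by (simp add: b_def power_mult_distrib)
      then have ab: "a\<^sup>2 + b\<^sup>2 = g\<^sup>2" unfolding g2 a_def by algebra
      have "Complex a b \<in> eigvals ?A"
      proof (rule eigval_of_quadratic_relation[OF \<open>x \<noteq> 0\<close>])
        show "?A *v (?A *v x) = (2 * a) *\<^sub>R (?A *v x) - (a\<^sup>2 + b\<^sup>2) *\<^sub>R x"
          unfolding ab unfolding g2 A_eq a_def by (rule T_quadratic[OF x(3)])
      qed
      moreover have "cmod (Complex a b) = g"
        using ab g0 by (simp add: cmod_def)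
      ultimately show ?thesis
        unfolding hg using g0 g1 contraction sharp x(1) \<open>x \<noteq> 0\<close> by blast
    qed
    then have h0: "0 \<le> h" and h1: "h < 1"
      and contraction: "\<And>x. x \<in> E\<^sup>\<bottom> \<Longrightarrow> norm (?A *v x) \<le> h * norm x"
      and sharp: "h \<noteq> 0 \<Longrightarrow> \<exists>x\<in>E\<^sup>\<bottom>. x \<noteq> 0 \<and> (\<forall>k. norm (matpow ?A k *v x) = h ^ k * norm x)"
      and eig: "h \<noteq> 0 \<Longrightarrow> \<exists>z\<in>eigvals ?A. cmod z = h"
      by blast+
    have "gamma_mat ?A = h"
      using h0 h1 eigval_norm_le[OF subspace_E fixes_E invariant contraction h0] eig
      by (rule gamma_mat_eqI)
    moreover have "is_optimal_conv_rate ?A (proj_mat E) h"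
      by (rule optimal_conv_rateI[OF subspace_E fixes_E invariant contraction h0 h1 sharp])
    ultimately show ?thesis ..
  qed
  have converges: "mat_convergent_to ?A (proj_mat E)" if "\<mu> \<in> {0<..<2}"
    using rate[OF that refl] unfolding is_optimal_conv_rate_def by (blast intro: conv_rate_imp_convergent)
  have convergent_iff: "mat_convergent ?A \<longleftrightarrow> \<mu> \<in> {0..<2}" if "U \<noteq> V"
  proof
    assume conv: "mat_convergent ?A"
    show "\<mu> \<in> {0..<2}"
    proof (rule ccontr)
      assume "\<mu> \<notin> {0..<2}"
      then have "\<mu> \<notin> {0<..<2}" "\<mu> \<noteq> 0" by auto
      then have "?A *v x = x" for x
        using norm_T_ge by (intro expanding_convergent_imp_identity[OF _ conv]) (simp add: A_eq)
      then have "\<mu> *\<^sub>R (R x - x) = 0" for x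
        unfolding A_eq T_def by (metis (no_types) add_diff_cancel_left' scaleR_left_diff_distrib
            scaleR_one scaleR_right_diff_distrib diff_add_eq diff_self)
      then have "R x = x" for x using \<open>\<mu> \<noteq> 0\<close> by simp
      then have "E = UNIV" using R_fixed_iff by blast
      with E_proper[OF that] show False by simp
    qed
  next
    assume "\<mu> \<in> {0..<2}"
    then consider "\<mu> = 0" | "\<mu> \<in> {0<..<2}" by fastforce
    then show "mat_convergent ?A"
    proof cases
      case 1
      have "matpow (mat 1 :: real^'n^'n) k = mat 1" for k by (induction k) simp_all
      moreover have "opnorm (0 :: real^'n^'n) = 0"
        using opnorm_le[of "0 :: real^'n^'n" 0] opnorm_nonneg[of "0 :: real^'n^'n"] by simp
      ultimately have "mat_convergent_to ?A (mat 1)"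
        by (simp add: 1 mat_convergent_to_def relaxed_dr_mat_def)
      then show ?thesis unfolding mat_convergent_def ..
    next
      case 2
      then show ?thesis using converges unfolding mat_convergent_def by blast
    qed
  qed
  have trivial: "(U \<inter> V) \<inter> (U\<^sup>\<bottom> \<inter> V\<^sup>\<bottom>) = {0}"
    using orthogonal_comp_Int_self subspace_0[OF U] subspace_0[OF V]
      subspace_0[OF subspace_orthogonal_comp] by blast
  show ?thesis
    unfolding fix_E E_sum[symmetric] angle c_def[symmetric] g_def[symmetric]
    using convergent_iff normal_relaxed_dr_mat[OF U V] converges trivial rate by simp
qed

end
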